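(* Let $p\in(1,\infty)$. If a discrete group $\Gamma$ has property RD$_p$ with respect to a length function of negative type, then $\Gamma$ has the $p$-invariant translation approximation property ($p$-ITAP). In particular, if $\Gamma$ has property RD$_2$ with respect to a length function of negative type, then $\Gamma$ has the $p$-ITAP for all $p\in(1,\infty)$.
   Context: Length functions: a length function on $\Gamma$ is a function $l:\Gamma\to[0,\infty)$ with $l(e)=0$, $l(g)=l(g^{-1})$ and $l(gh)\le l(g)+l(h)$ for all $g,h\in\Gamma$. It is of negative type if $\sum_{i,j=1}^n\lambda_i\overline{\lambda_j}\,l(g_i^{-1}g_j)\le 0$ for all $n$, all $g_1,\dots,g_n\in\Gamma$ and all $\lambda_1,\dots,\lambda_n\in\mathbb{C}$ with $\sum_i\lambda_i=0$. Property RD$_p$ ($p\in[1,\infty)$): $\Gamma$ has property RD$_p$ with respect to a length function $l$ if there are $C>0$ and $s>0$ such that for all $f\in\mathbb{C}\Gamma$, $\|f\|_{B(\ell^p(\Gamma))}\le C\|f(1+l)^s\|_{\ell^p(\Gamma)}$, where $\|f\|_{B(\ell^p(\Gamma))}$ is the norm of the left convolution operator $\sum_g f(g)\lambda_g$ on $\ell^p(\Gamma)$. Convention: a discrete group $\Gamma$ is equipped with a proper right-invariant metric $d$ (i.e. $d(sg,tg)=d(s,t)$ and all balls are finite; in particular $\Gamma$ is countable), and $|\Gamma|$ denotes the resulting metric space, which has bounded geometry. For $T\in B(\ell^p(\Gamma))$ write $T_{s,t}=\langle T\delta_t,\delta_s\rangle$ and $\mathrm{prop}(T)=\sup\{d(s,t):T_{s,t}\neq0\}$.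 $B^p_u|\Gamma|$ is the operator norm closure in $B(\ell^p(\Gamma))$ of the algebra of operators with finite propagation. (An operator has finite propagation iff there is a finite $F\subseteq\Gamma$ with $T_{s,t}=0$ unless $st^{-1}\in F$, so $B^p_u|\Gamma|$ does not depend on the metric chosen.) The left and right regular representations on $\ell^p(\Gamma)$ are $(\lambda_sf)(t)=f(s^{-1}t)$ and $(\rho_sf)(t)=f(ts)$. $F^p_\lambda(\Gamma)$ is the norm-closed subalgebra of $B(\ell^p(\Gamma))$ generated by $\lambda(\Gamma)$; it is contained in $B^p_u|\Gamma|$. $\Gamma$ acts on $B^p_u|\Gamma|$ by $\mathrm{Ad}(\rho_g)(T)=\rho_gT\rho_{g^{-1}}$, and $B^p_u|\Gamma|^\Gamma$ denotes the set of fixed points. For $1<p<\infty$, $\Gamma$ has the $p$-ITAP if $F^p_\lambda(\Gamma)=B^p_u|\Gamma|^\Gamma$. *)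

theory Defs
  imports "HOL-Analysis.Analysis" "HOL-Library.Complex_Order"
begin

(* The discrete group is a type of class group_add.  This class does not assume commutativity;
   the group product gh is written g + h, the inverse is - g and the unit is 0. *)

definition length_function :: "('g::group_add \<Rightarrow> real) \<Rightarrow> bool" where
  "length_function l \<longleftrightarrow>
     (\<forall>g. 0 \<le> l g) \<and> l 0 = 0 \<and> (\<forall>g. l g = l (- g)) \<and> (\<forall>g h. l (g + h) \<le> l g + l h)"

(* The order on complex is that of Complex_Order: z \<le> 0 means that z is real and nonpositive. *)
definition negative_type :: "('g::group_add \<Rightarrow> real) \<Rightarrow> bool" where
  "negative_type l \<longleftrightarrow>
     (\<forall>(n::nat) (g::nat \<Rightarrow> 'g) (c::nat \<Rightarrow> complex). (\<Sum>i<n. c i) = 0 \<longrightarrow>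
        (\<Sum>i<n. \<Sum>j<n. c i * cnj (c j) * complex_of_real (l (- g i + g j))) \<le> 0)"

definition proper_right_invariant_metric :: "('g::group_add \<Rightarrow> 'g \<Rightarrow> real) \<Rightarrow> bool" where
  "proper_right_invariant_metric d \<longleftrightarrow>
     Metric_space UNIV d \<and>
     (\<forall>s t g. d (s + g) (t + g) = d s t) \<and>
     (\<forall>x r. finite (Metric_space.mball UNIV d x r))"

definition lp_space :: "real \<Rightarrow> ('g \<Rightarrow> complex) set" where
  "lp_space p = {f. (\<lambda>x. norm (f x) powr p) summable_on UNIV}"

definition lp_norm :: "real \<Rightarrow> ('g \<Rightarrow> complex) \<Rightarrow> real" where
  "lp_norm p f = (\<Sum>\<^sub>\<infinity>x. norm (f x) powr p) powr (1 / p)"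

(* An operator on the p-summable functions is encoded as a function on all of 'g \<Rightarrow> complex that
   vanishes outside lp_space p.  Equality of operators is then equality of functions, and the
   algebra operations are the pointwise ones and composition. *)
definition bounded_operators :: "real \<Rightarrow> (('g \<Rightarrow> complex) \<Rightarrow> ('g \<Rightarrow> complex)) set" where
  "bounded_operators p = {T.
     (\<forall>f\<in>lp_space p. T f \<in> lp_space p) \<and>
     (\<forall>f\<in>lp_space p. \<forall>h\<in>lp_space p. T (\<lambda>x. f x + h x) = (\<lambda>x. T f x + T h x)) \<and>
     (\<forall>c. \<forall>f\<in>lp_space p. T (\<lambda>x. c * f x) = (\<lambda>x. c * T f x)) \<and>
     (\<exists>C. \<forall>f\<in>lp_space p. lp_norm p (T f) \<le> C * lp_norm p f) \<and>
     (\<forall>f. f \<notin> lp_space p \<longrightarrow> T f = (\<lambda>x. 0))}"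

definition op_norm :: "real \<Rightarrow> (('g \<Rightarrow> complex) \<Rightarrow> ('g \<Rightarrow> complex)) \<Rightarrow> real" where
  "op_norm p T = (SUP f\<in>{f \<in> lp_space p. lp_norm p f \<le> 1}. lp_norm p (T f))"

definition op_closure ::
  "real \<Rightarrow> (('g \<Rightarrow> complex) \<Rightarrow> ('g \<Rightarrow> complex)) set \<Rightarrow> (('g \<Rightarrow> complex) \<Rightarrow> ('g \<Rightarrow> complex)) set" where
  "op_closure p A =
     {T \<in> bounded_operators p. \<forall>e>0. \<exists>S\<in>A. op_norm p (\<lambda>f x. T f x - S f x) < e}"

definition closed_subalgebra :: "real \<Rightarrow> (('g \<Rightarrow> complex) \<Rightarrow> ('g \<Rightarrow> complex)) set \<Rightarrow> bool" where
  "closed_subalgebra p A \<longleftrightarrow>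
     A \<subseteq> bounded_operators p \<and>
     (\<lambda>f x. 0) \<in> A \<and>
     (\<forall>S\<in>A. \<forall>T\<in>A. (\<lambda>f x. S f x + T f x) \<in> A) \<and>
     (\<forall>c. \<forall>T\<in>A. (\<lambda>f x. c * T f x) \<in> A) \<and>
     (\<forall>S\<in>A. \<forall>T\<in>A. S \<circ> T \<in> A) \<and>
     op_closure p A \<subseteq> A"

definition left_regular ::
  "real \<Rightarrow> 'g::group_add \<Rightarrow> ('g \<Rightarrow> complex) \<Rightarrow> ('g \<Rightarrow> complex)" where
  "left_regular p s f = (if f \<in> lp_space p then (\<lambda>t. f (- s + t)) else (\<lambda>t. 0))"

definition right_regular ::
  "real \<Rightarrow> 'g::group_add \<Rightarrow> ('g \<Rightarrow> complex) \<Rightarrow> ('g \<Rightarrow> complex)" where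
  "right_regular p s f = (if f \<in> lp_space p then (\<lambda>t. f (t + s)) else (\<lambda>t. 0))"

(* Intended for finitely supported a. *)
definition left_convolution ::
  "real \<Rightarrow> ('g::group_add \<Rightarrow> complex) \<Rightarrow> ('g \<Rightarrow> complex) \<Rightarrow> ('g \<Rightarrow> complex)" where
  "left_convolution p a f = (\<lambda>t. \<Sum>g | a g \<noteq> 0. a g * left_regular p g f t)"

definition property_RD :: "real \<Rightarrow> ('g::group_add \<Rightarrow> real) \<Rightarrow> bool" where
  "property_RD p l \<longleftrightarrow>
     (\<exists>C>0. \<exists>s>0. \<forall>a::'g \<Rightarrow> complex. finite {g. a g \<noteq> 0} \<longrightarrow>
        op_norm p (left_convolution p a)
          \<le> C * lp_norm p (\<lambda>g. a g * complex_of_real ((1 + l g) powr s)))"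

definition matrix_entry ::
  "(('g \<Rightarrow> complex) \<Rightarrow> ('g \<Rightarrow> complex)) \<Rightarrow> 'g \<Rightarrow> 'g \<Rightarrow> complex" where
  "matrix_entry T s t = T (indicator {t}) s"

(* Taken in ennreal, so that the supremum always exists and is 0 for the zero operator. *)
definition propagation ::
  "('g \<Rightarrow> 'g \<Rightarrow> real) \<Rightarrow> (('g \<Rightarrow> complex) \<Rightarrow> ('g \<Rightarrow> complex)) \<Rightarrow> ennreal" where
  "propagation d T = (SUP (s, t)\<in>{(s, t). matrix_entry T s t \<noteq> 0}. ennreal (d s t))"

definition uniform_Roe_algebra ::
  "real \<Rightarrow> ('g \<Rightarrow> 'g \<Rightarrow> real) \<Rightarrow> (('g \<Rightarrow> complex) \<Rightarrow> ('g \<Rightarrow> complex)) set" where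
  "uniform_Roe_algebra p d = op_closure p {T \<in> bounded_operators p. propagation d T < \<infinity>}"

definition invariant_uniform_Roe_algebra ::
  "real \<Rightarrow> ('g::group_add \<Rightarrow> 'g \<Rightarrow> real) \<Rightarrow> (('g \<Rightarrow> complex) \<Rightarrow> ('g \<Rightarrow> complex)) set" where
  "invariant_uniform_Roe_algebra p d =
     {T \<in> uniform_Roe_algebra p d. \<forall>g. right_regular p g \<circ> T \<circ> right_regular p (- g) = T}"

definition reduced_group_algebra ::
  "real \<Rightarrow> (('g::group_add \<Rightarrow> complex) \<Rightarrow> ('g \<Rightarrow> complex)) set" where
  "reduced_group_algebra p = closed_subalgebra p hull range (left_regular p)"

definition ITAP :: "real \<Rightarrow> ('g::group_add \<Rightarrow> 'g \<Rightarrow> real) \<Rightarrow> bool" where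
  "ITAP p d \<longleftrightarrow> reduced_group_algebra p = invariant_uniform_Roe_algebra p d"

end

theory Submission
  imports Defs "HOL-Real_Asymp.Real_Asymp"
begin

text \<open>
  An invariant operator \<open>T\<close> has matrix entries \<open>a (s - t)\<close>, where the symbol \<open>a\<close> is its column
  at the unit, and one cuts \<open>a\<close> off by the functions \<open>exp (- \<tau> * l)\<close>.  Since \<open>l\<close> is of negative
  type, on every finite set \<open>l (s - t)\<close> is the squared distance \<open>\<bar>v s - v t\<bar>\<^sup>2\<close> of vectors in
  some Euclidean space, and Schur multiplication by a Gaussian in \<open>v s - v t\<close> is a limit of averages
  of conjugations by diagonal unitaries.  It is therefore contractive on every \<open>\<ell>\<^sup>p\<close>.  By contractivity and
  density of finite propagation, the multiplied operators converge to \<open>T\<close> as \<open>\<tau>\<close> tends to 0; for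
  fixed \<open>\<tau>\<close>, the function \<open>exp (- \<tau> * l) * (1 + l) powr s\<close> is bounded, so by rapid decay the
  multiplied operator is a norm limit of convolutions by finitely supported functions.

  Rapid decay for exponent 2 gives it for exponents below 2, because convolution of nonnegative
  functions interpolates by Hoelder's inequality alone.  For exponents above 2 one transposes: the
  operator norm is then controlled by a weighted norm with the conjugate exponent, and the symbol
  of a bounded operator has finite norm for that exponent because it is, up to inversion, a row of
  the matrix.
\<close>

subsection \<open>Finite p-norms and matrices bounded on them\<close>

text \<open>Two obstacles shape the proof: a Schur product is a matrix not yet known to come from an
  operator, and the Euclidean embedding exists only on finite sets. Both disappear once bounds are
  demanded of finite sections alone, uniformly, as in \<open>matrix_bound\<close>. These bounds
  survive Schur multiplication, entrywise limits and transposition. They return to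
  \<open>op_norm\<close> only for differences of operators already at hand, so the heat-multiplied
  matrix is never realised as an operator.

  The operator exponent and the exponent of the weighted norm are kept apart in
  \<open>convolution_bound\<close>. Above 2, transposition leaves a weighted norm with the smaller
  conjugate exponent, which for the same weight is a larger norm and thus a weaker bound than rapid
  decay asks for. It suffices, since the symbol only has to lie in the unweighted space of that
  exponent: the heat factor absorbs the weight.

  The interpolation runs between rapid decay at 2 and the trivial bound of convolution on
  \<open>\<ell>\<close> with exponent 1. Passing to absolute values is harmless because the weighted
  norm sees nothing else.\<close>

lemma sum_powr_mult_le:
  fixes x y :: "'a \<Rightarrow> real"
  assumes "0 < \<alpha>" "0 < \<beta>" "\<alpha> + \<beta> = 1"
    and x: "\<And>i. i \<in> F \<Longrightarrow> 0 \<le> x i" and y: "\<And>i. i \<in> F \<Longrightarrow> 0 \<le> y i"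
  shows "(\<Sum>i\<in>F. x i powr \<alpha> * y i powr \<beta>) \<le> (\<Sum>i\<in>F. x i) powr \<alpha> * (\<Sum>i\<in>F. y i) powr \<beta>"
proof (cases "finite F \<and> sum x F \<noteq> 0 \<and> sum y F \<noteq> 0")
  \<comment> \<open>An infinite \<open>F\<close> has zero sums by convention, and a vanishing sum of
    nonnegative terms makes every product vanish.\<close>
  case False
  have "x i powr \<alpha> * y i powr \<beta> = 0" if "finite F" "i \<in> F" for i
    using False that x y sum_nonneg_eq_0_iff[of F x] sum_nonneg_eq_0_iff[of F y] by auto
  then have "(\<Sum>i\<in>F. x i powr \<alpha> * y i powr \<beta>) = 0"
    by (meson sum.infinite sum.neutral)
  then show ?thesis by simp
next
  case True
  then have fin: "finite F" by blast
  have X: "sum x F > 0" and Y: "sum y F > 0"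
    using True x y by (simp_all add: order_less_le sum_nonneg)
  have young: "a powr \<alpha> * b powr \<beta> \<le> \<alpha> * a + \<beta> * b" if "a \<ge> 0" "b \<ge> 0" for a b :: real
  proof (cases "a = 0 \<or> b = 0")
    case True
    with that assms show ?thesis by auto
  next
    case False
    with that assms show ?thesis by (intro Youngs_inequality_0) auto
  qed
  \<comment> \<open>By homogeneity both sums may be scaled to 1; Young's inequality then applies
    term by term, and the weights add up to 1.\<close>
  have "(\<Sum>i\<in>F. x i powr \<alpha> * y i powr \<beta>)
      = (\<Sum>i\<in>F. (x i / sum x F) powr \<alpha> * (y i / sum y F) powr \<beta>) * (sum x F powr \<alpha> * sum y F powr \<beta>)"
    unfolding sum_distrib_right
    by (rule sum.cong) (use X Y x y in \<open>auto simp: powr_divide\<close>)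
  also have "(\<Sum>i\<in>F. (x i / sum x F) powr \<alpha> * (y i / sum y F) powr \<beta>)
      \<le> (\<Sum>i\<in>F. \<alpha> * (x i / sum x F) + \<beta> * (y i / sum y F))"
    by (intro sum_mono young) (use X Y x y in auto)
  also have "\<dots> = \<alpha> * (sum x F / sum x F) + \<beta> * (sum y F / sum y F)"
    by (simp only: sum.distrib sum_distrib_left[symmetric] sum_divide_distrib[symmetric])
  also have "\<dots> = 1" using X Y assms by simp
  finally show ?thesis by (simp add: mult_right_mono)
qed

definition pnorm :: "real \<Rightarrow> 'a set \<Rightarrow> ('a \<Rightarrow> 'b::real_normed_vector) \<Rightarrow> real" where
  "pnorm p F f = (\<Sum>x\<in>F. norm (f x) powr p) powr (1 / p)"

lemma pnorm_nonneg [simp]: "0 \<le> pnorm p F f"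
  by (simp add: pnorm_def)

lemma pnorm_cong: "(\<And>x. x \<in> F \<Longrightarrow> norm (f x) = norm (g x)) \<Longrightarrow> pnorm p F f = pnorm p F g"
  by (simp add: pnorm_def)

lemma pnorm_powr: "p > 0 \<Longrightarrow> pnorm p F f powr p = (\<Sum>x\<in>F. norm (f x) powr p)"
  by (simp add: pnorm_def powr_powr sum_nonneg)

lemma pnorm_le_iff:
  assumes "p > 0" "c \<ge> 0"
  shows "pnorm p F f \<le> c \<longleftrightarrow> (\<Sum>x\<in>F. norm (f x) powr p) \<le> c powr p"
proof -
  have "pnorm p F f \<le> c \<longleftrightarrow> pnorm p F f powr p \<le> c powr p"
    using assms by (metis pnorm_nonneg powr_less_mono2 powr_mono2 linorder_not_le order_less_imp_le)
  then show ?thesis using assms by (simp add: pnorm_powr)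
qed

lemma pnorm_le_pnorm:
  assumes "p > 0" "finite G" "F \<subseteq> G" "\<And>x. x \<in> F \<Longrightarrow> norm (f x) \<le> norm (g x)"
  shows "pnorm p F f \<le> pnorm p G g"
  unfolding pnorm_def
proof (rule powr_mono2)
  have "(\<Sum>x\<in>F. norm (f x) powr p) \<le> (\<Sum>x\<in>F. norm (g x) powr p)"
    by (intro sum_mono powr_mono2) (use assms in auto)
  also have "\<dots> \<le> (\<Sum>x\<in>G. norm (g x) powr p)"
    by (intro sum_mono2) (use assms in auto)
  finally show "(\<Sum>x\<in>F. norm (f x) powr p) \<le> (\<Sum>x\<in>G. norm (g x) powr p)" .
qed (use assms in \<open>auto simp: sum_nonneg\<close>)

lemma norm_le_pnorm:
  assumes "p > 0" "finite F" "x \<in> F"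
  shows "norm (f x) \<le> pnorm p F f"
  using pnorm_le_pnorm[of p F "{x}" f f] assms by (simp add: pnorm_def powr_powr)

lemma pnorm_mult:
  fixes c :: "'b::real_normed_div_algebra"
  assumes "p > 0"
  shows "pnorm p F (\<lambda>x. c * f x) = norm c * pnorm p F f"
proof -
  have "(\<Sum>x\<in>F. norm (c * f x) powr p) = norm c powr p * (\<Sum>x\<in>F. norm (f x) powr p)"
    by (simp add: norm_mult powr_mult sum_distrib_left)
  then show ?thesis
    using assms by (simp add: pnorm_def powr_mult sum_nonneg powr_powr)
qed

lemma Holder_inequality_sum:
  fixes f :: "'a \<Rightarrow> 'b::real_normed_vector" and g :: "'a \<Rightarrow> 'c::real_normed_vector"
  assumes "p > 1" "q > 1" "1/p + 1/q = 1"
  shows "(\<Sum>x\<in>F. norm (f x) * norm (g x)) \<le> pnorm p F f * pnorm q F g"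
  using sum_powr_mult_le[of "1/p" "1/q" F "\<lambda>x. norm (f x) powr p" "\<lambda>x. norm (g x) powr q"] assms
  by (simp add: pnorm_def powr_powr)

text \<open>The converse of Hoelder's inequality. The test function
  \<open>norm (g x) powr (p - 1)\<close> is its case of equality, and \<open>q * (p - 1) = p\<close>
  makes the q-norm of that function a power of the same sum \<open>N\<close>.\<close>

lemma pnorm_le_dual:
  fixes g :: "'a \<Rightarrow> 'b::real_normed_vector"
  assumes pq: "p > 1" "q > 1" "1/p + 1/q = 1" and "c \<ge> 0"
    and le: "\<And>h::'a \<Rightarrow> real. (\<And>x. h x \<ge> 0) \<Longrightarrow> (\<Sum>x\<in>F. norm (g x) * h x) \<le> c * pnorm q F h"
  shows "pnorm p F g \<le> c"
proof (cases "(\<Sum>x\<in>F. norm (g x) powr p) = 0")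
  case True
  then show ?thesis using \<open>c \<ge> 0\<close> by (simp add: pnorm_def)
next
  case False
  define N where "N = (\<Sum>x\<in>F. norm (g x) powr p)"
  have N: "N > 0" using False by (simp add: N_def order_less_le sum_nonneg)
  have "q * (p - 1) = p"
    using pq by (simp add: field_simps)
  then have "norm (norm (g x) powr (p - 1)) powr q = norm (g x) powr p" for x
    by (simp add: powr_powr mult.commute)
  then have h: "pnorm q F (\<lambda>x. norm (g x) powr (p - 1)) = N powr (1/q)"
    by (simp add: pnorm_def N_def)
  have "norm (g x) powr p = norm (g x) * norm (g x) powr (p - 1)" for x
    by (cases "g x = 0") (simp_all add: powr_mult_base)
  then have "N = (\<Sum>x\<in>F. norm (g x) * norm (g x) powr (p - 1))"
    by (simp add: N_def)
  also have "\<dots> \<le> c * N powr (1/q)"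
    using le[of "\<lambda>x. norm (g x) powr (p - 1)"] h by simp
  finally have "N powr (1 - 1/q) \<le> c"
    using N by (simp add: powr_diff pos_divide_le_eq del: powr_le_cancel_iff)
  moreover have "1 - 1/q = 1/p" using pq by simp
  ultimately show ?thesis by (simp add: pnorm_def N_def)
qed

lemma conjugate_exponent:
  fixes p :: real
  assumes "p > 1"
  obtains q where "q > 1" "1/p + 1/q = 1"
  using assms by (intro that[of "p / (p - 1)"]) (auto simp: field_simps)

text \<open>Minkowski's inequality by duality: after pairing with \<open>h\<close>, only the
  pointwise triangle inequality and two uses of Hoelder remain.\<close>

lemma pnorm_triangle:
  assumes "p > 1"
  shows "pnorm p F (\<lambda>x. f x + g x) \<le> pnorm p F f + pnorm p F g"
proof -
  obtain q where q: "q > 1" "1/p + 1/q = 1"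
    using conjugate_exponent[OF assms] .
  show ?thesis
  proof (rule pnorm_le_dual[OF assms q])
    fix h :: "'a \<Rightarrow> real" assume h: "\<And>x. h x \<ge> 0"
    have "(\<Sum>x\<in>F. norm (f x + g x) * h x)
        \<le> (\<Sum>x\<in>F. norm (f x) * norm (h x) + norm (g x) * norm (h x))"
      by (intro sum_mono) (use h in \<open>simp add: mult_right_mono norm_triangle_ineq flip: distrib_right\<close>)
    also have "\<dots> \<le> pnorm p F f * pnorm q F h + pnorm p F g * pnorm q F h"
      unfolding sum.distrib by (intro add_mono Holder_inequality_sum assms q)
    finally show "(\<Sum>x\<in>F. norm (f x + g x) * h x) \<le> (pnorm p F f + pnorm p F g) * pnorm q F h"
      by (simp add: distrib_right)
  qed simp
qed

text \<open>For the matrix of a bounded operator this says that its norm is at most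
  \<open>c\<close>. Stated through finite sections, it also makes sense for matrices that have not
  been shown to define an operator, and each instance involves finitely many entries.\<close>

definition matrix_bound :: "real \<Rightarrow> ('a \<Rightarrow> 'b \<Rightarrow> complex) \<Rightarrow> real \<Rightarrow> bool" where
  "matrix_bound p A c \<longleftrightarrow> (\<forall>F E f. finite F \<longrightarrow> finite E \<longrightarrow>
     pnorm p F (\<lambda>s. \<Sum>t\<in>E. A s t * f t) \<le> c * pnorm p E f)"

lemma matrix_boundI:
  "(\<And>F E f. finite F \<Longrightarrow> finite E \<Longrightarrow> pnorm p F (\<lambda>s. \<Sum>t\<in>E. A s t * f t) \<le> c * pnorm p E f)
    \<Longrightarrow> matrix_bound p A c"
  by (simp add: matrix_bound_def)

lemma matrix_boundD:
  "matrix_bound p A c \<Longrightarrow> finite F \<Longrightarrow> finite E \<Longrightarrow>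
    pnorm p F (\<lambda>s. \<Sum>t\<in>E. A s t * f t) \<le> c * pnorm p E f"
  by (simp add: matrix_bound_def)

lemma matrix_bound_column:
  assumes "matrix_bound p A c" "p > 0" "finite F"
  shows "pnorm p F (\<lambda>s. A s t) \<le> c"
  using matrix_boundD[OF assms(1,3), of "{t}" "\<lambda>_. 1"] assms(2) by (simp add: pnorm_def)

lemma matrix_bound_entry:
  assumes "matrix_bound p A c" "p > 0"
  shows "norm (A s t) \<le> c"
  using matrix_bound_column[OF assms, of "{s}"] assms(2) by (simp add: pnorm_def powr_powr)

lemma matrix_bound_nonneg: "matrix_bound p A c \<Longrightarrow> p > 0 \<Longrightarrow> 0 \<le> c"
  using matrix_bound_entry[of p A c] norm_ge_zero order_trans by blast

lemma matrix_bound_mono: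
  assumes "matrix_bound p A c" "c \<le> c'"
  shows "matrix_bound p A c'"
  by (rule matrix_boundI, rule order_trans[OF matrix_boundD[OF assms(1)]])
    (simp_all add: assms(2) mult_right_mono)

lemma matrix_bound_add:
  fixes A :: "'a \<Rightarrow> 'b \<Rightarrow> complex"
  assumes "matrix_bound p A a" "matrix_bound p B b" "p > 1"
  shows "matrix_bound p (\<lambda>s t. A s t + B s t) (a + b)"
proof (rule matrix_boundI)
  fix F :: "'a set" and E :: "'b set" and f :: "'b \<Rightarrow> complex" assume "finite F" "finite E"
  then show "pnorm p F (\<lambda>s. \<Sum>t\<in>E. (A s t + B s t) * f t) \<le> (a + b) * pnorm p E f"
    using pnorm_triangle[OF assms(3), of F "\<lambda>s. \<Sum>t\<in>E. A s t * f t" "\<lambda>s. \<Sum>t\<in>E. B s t * f t"]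
      matrix_boundD[OF assms(1), of F E f] matrix_boundD[OF assms(2), of F E f]
    by (simp add: distrib_right sum.distrib)
qed

lemma matrix_bound_mult:
  fixes A :: "'a \<Rightarrow> 'b \<Rightarrow> complex"
  assumes "matrix_bound p A a" "p > 0"
  shows "matrix_bound p (\<lambda>s t. c * A s t) (norm c * a)"
proof (rule matrix_boundI)
  fix F :: "'a set" and E :: "'b set" and f :: "'b \<Rightarrow> complex" assume *: "finite F" "finite E"
  have "pnorm p F (\<lambda>s. \<Sum>t\<in>E. c * A s t * f t) = norm c * pnorm p F (\<lambda>s. \<Sum>t\<in>E. A s t * f t)"
    by (simp only: pnorm_mult[OF assms(2), symmetric] sum_distrib_left mult.assoc)
  also have "\<dots> \<le> norm c * (a * pnorm p E f)"
    by (intro mult_left_mono matrix_boundD[OF assms(1) *] norm_ge_zero)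
  finally show "pnorm p F (\<lambda>s. \<Sum>t\<in>E. c * A s t * f t) \<le> norm c * a * pnorm p E f"
    by (simp only: mult.assoc)
qed

lemma matrix_bound_zero: "matrix_bound p (\<lambda>_ _. 0) 0"
  by (simp add: matrix_bound_def pnorm_def)

lemma matrix_bound_sum:
  assumes "finite I" "p > 1" "\<And>i. i \<in> I \<Longrightarrow> matrix_bound p (A i) (c i)"
  shows "matrix_bound p (\<lambda>s t. \<Sum>i\<in>I. A i s t) (\<Sum>i\<in>I. c i)"
  using assms(1,3)
  by (induction I rule: finite_induct) (auto intro!: matrix_bound_zero matrix_bound_add \<open>p > 1\<close>)

text \<open>Multiplication by a function of modulus 1 is isometric for every exponent. This is what
  frees the Schur multiplier argument from Hilbert space.\<close>

lemma matrix_bound_unimodular: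
  fixes A :: "'a \<Rightarrow> 'b \<Rightarrow> complex"
  assumes A: "matrix_bound p A c" and "\<And>s. norm (u s) = 1" "\<And>t. norm (v t) = 1"
  shows "matrix_bound p (\<lambda>s t. u s * v t * A s t) c"
proof (rule matrix_boundI)
  fix F :: "'a set" and E :: "'b set" and f :: "'b \<Rightarrow> complex" assume *: "finite F" "finite E"
  have "pnorm p F (\<lambda>s. \<Sum>t\<in>E. u s * v t * A s t * f t) = pnorm p F (\<lambda>s. \<Sum>t\<in>E. A s t * (v t * f t))"
  proof (rule pnorm_cong)
    fix s
    have "(\<Sum>t\<in>E. u s * v t * A s t * f t) = u s * (\<Sum>t\<in>E. A s t * (v t * f t))"
      by (simp add: sum_distrib_left mult_ac)
    then show "norm (\<Sum>t\<in>E. u s * v t * A s t * f t) = norm (\<Sum>t\<in>E. A s t * (v t * f t))"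
      by (simp add: norm_mult assms)
  qed
  also have "\<dots> \<le> c * pnorm p E (\<lambda>t. v t * f t)"
    by (rule matrix_boundD[OF A *])
  also have "pnorm p E (\<lambda>t. v t * f t) = pnorm p E f"
    by (rule pnorm_cong) (simp add: norm_mult assms)
  finally show "pnorm p F (\<lambda>s. \<Sum>t\<in>E. u s * v t * A s t * f t) \<le> c * pnorm p E f" .
qed

text \<open>Entrywise convergence is enough because each inequality involves only finitely many
  entries, on which it is a closed condition.\<close>

lemma matrix_bound_limit:
  fixes A :: "nat \<Rightarrow> 'a \<Rightarrow> 'b \<Rightarrow> complex"
  assumes "p > 0" and A: "\<And>n. matrix_bound p (A n) c"
    and lim: "\<And>s t. (\<lambda>n. A n s t) \<longlonglongrightarrow> B s t"
  shows "matrix_bound p B c"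
proof (rule matrix_boundI)
  fix F :: "'a set" and E :: "'b set" and f :: "'b \<Rightarrow> complex" assume *: "finite F" "finite E"
  have c: "c * pnorm p E f \<ge> 0" by (simp add: matrix_bound_nonneg[OF A \<open>p > 0\<close>])
  have "(\<lambda>n. \<Sum>s\<in>F. norm (\<Sum>t\<in>E. A n s t * f t) powr p) \<longlonglongrightarrow> (\<Sum>s\<in>F. norm (\<Sum>t\<in>E. B s t * f t) powr p)"
    by (intro tendsto_intros tendsto_powr2 lim) (use \<open>p > 0\<close> in auto)
  moreover have "(\<Sum>s\<in>F. norm (\<Sum>t\<in>E. A n s t * f t) powr p) \<le> (c * pnorm p E f) powr p" for n
    using matrix_boundD[OF A *, of n f] by (simp only: pnorm_le_iff[OF \<open>p > 0\<close> c])
  ultimately have "(\<Sum>s\<in>F. norm (\<Sum>t\<in>E. B s t * f t) powr p) \<le> (c * pnorm p E f) powr p"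
    by (intro LIMSEQ_le_const2) auto
  then show "pnorm p F (\<lambda>s. \<Sum>t\<in>E. B s t * f t) \<le> c * pnorm p E f"
    by (simp only: pnorm_le_iff[OF \<open>p > 0\<close> c])
qed

text \<open>Duality of the exponents through the bilinear pairing, without complex conjugation. A
  convolution matrix thus becomes the convolution matrix of the symbol composed with
  inversion.\<close>

lemma matrix_bound_transpose:
  fixes A :: "'a \<Rightarrow> 'b \<Rightarrow> complex"
  assumes pq: "p > 1" "q > 1" "1/p + 1/q = 1" and A: "matrix_bound p A c"
  shows "matrix_bound q (\<lambda>s t. A t s) c"
proof (rule matrix_boundI)
  fix F :: "'b set" and E :: "'a set" and f :: "'a \<Rightarrow> complex" assume *: "finite F" "finite E"
  define g where "g = (\<lambda>s. \<Sum>t\<in>E. A t s * f t)"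
  have c: "c \<ge> 0" using matrix_bound_nonneg[OF A] pq by simp
  show "pnorm q F g \<le> c * pnorm q E f"
  proof (rule pnorm_le_dual[of q p])
    fix h :: "'b \<Rightarrow> real" assume h: "\<And>x. h x \<ge> 0"
    \<comment> \<open>The phase of \<open>g\<close> is moved into the test function, so that the
      pairing becomes a sum of nonnegative reals and can be transposed.\<close>
    define k where "k s = cnj (sgn (g s)) * h s" for s
    have gk: "g s * k s = complex_of_real (norm (g s) * h s)" for s
    proof -
      have "g s * cnj (sgn (g s)) = norm (g s)"
        by (cases "g s = 0") (simp_all add: sgn_div_norm complex_norm_square[symmetric] power2_eq_square scaleR_conv_of_real field_simps)
      then show ?thesis by (simp add: k_def mult.assoc[symmetric])
    qed
    have nk: "pnorm p F k \<le> pnorm p F h"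
      by (rule pnorm_le_pnorm) (use * pq h in \<open>auto simp: k_def norm_mult norm_sgn\<close>)
    have "(\<Sum>s\<in>F. g s * k s) = (\<Sum>s\<in>F. \<Sum>t\<in>E. f t * (A t s * k s))"
      by (simp add: g_def sum_distrib_left sum_distrib_right mult_ac)
    also have "\<dots> = (\<Sum>t\<in>E. f t * (\<Sum>s\<in>F. A t s * k s))"
      by (subst sum.swap) (simp add: sum_distrib_left)
    finally have eq: "complex_of_real (\<Sum>s\<in>F. norm (g s) * h s) = (\<Sum>t\<in>E. f t * (\<Sum>s\<in>F. A t s * k s))"
      by (simp add: gk)
    have "(\<Sum>s\<in>F. norm (g s) * h s) \<le> norm (complex_of_real (\<Sum>s\<in>F. norm (g s) * h s))"
      by (simp only: norm_of_real abs_ge_self)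
    also have "\<dots> \<le> (\<Sum>t\<in>E. norm (f t) * norm (\<Sum>s\<in>F. A t s * k s))"
      unfolding eq by (rule order_trans[OF norm_sum]) (simp add: norm_mult)
    also have "\<dots> \<le> pnorm q E f * pnorm p E (\<lambda>t. \<Sum>s\<in>F. A t s * k s)"
      by (rule Holder_inequality_sum) (use pq in auto)
    also have "\<dots> \<le> pnorm q E f * (c * pnorm p F h)"
      by (intro mult_left_mono order_trans[OF matrix_boundD[OF A *(2,1)]] nk c pnorm_nonneg)
    finally show "(\<Sum>s\<in>F. norm (g s) * h s) \<le> c * pnorm q E f * pnorm p F h"
      by (simp add: mult_ac)
  qed (use pq c in auto)
qed

text \<open>With support on one translate of the diagonal, every row and column has at most one
  entry: the matrix is a weighted translation, and the largest entry controls it for every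
  exponent.\<close>

lemma matrix_bound_translate:
  fixes A :: "'g::group_add \<Rightarrow> 'g \<Rightarrow> complex"
  assumes "p > 0" "c \<ge> 0" and supp: "\<And>s t. A s t \<noteq> 0 \<Longrightarrow> s = g + t" and le: "\<And>s t. norm (A s t) \<le> c"
  shows "matrix_bound p A c"
proof (rule matrix_boundI)
  fix F E :: "'g set" and f :: "'g \<Rightarrow> complex" assume *: "finite F" "finite E"
  define F' where "F' = {s\<in>F. - g + s \<in> E}"
  have eq: "(\<Sum>t\<in>E. A s t * f t) = (if - g + s \<in> E then A s (- g + s) * f (- g + s) else 0)" for s
  proof -
    have "(\<Sum>t\<in>E. A s t * f t) = (\<Sum>t\<in>E. if t = - g + s then A s (- g + s) * f (- g + s) else 0)"
    proof (rule sum.cong)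
      fix t show "A s t * f t = (if t = - g + s then A s (- g + s) * f (- g + s) else 0)"
        using supp[of s t] by (metis add.assoc left_minus add_0 mult_eq_0_iff)
    qed simp
    also have "\<dots> = (if - g + s \<in> E then A s (- g + s) * f (- g + s) else 0)"
      by (rule sum.delta[OF *(2)])
    finally show ?thesis .
  qed
  have "pnorm p F (\<lambda>s. \<Sum>t\<in>E. A s t * f t) = pnorm p F' (\<lambda>s. A s (- g + s) * f (- g + s))"
  proof -
    have "(\<Sum>s\<in>F. norm (\<Sum>t\<in>E. A s t * f t) powr p) = (\<Sum>s\<in>F'. norm (A s (- g + s) * f (- g + s)) powr p)"
      by (rule sum.mono_neutral_cong_right) (use *(1) in \<open>auto simp: F'_def eq\<close>)
    then show ?thesis by (simp only: pnorm_def)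
  qed
  also have "\<dots> \<le> pnorm p F' (\<lambda>s. complex_of_real c * f (- g + s))"
    by (rule pnorm_le_pnorm) (use * assms(1,2) in \<open>auto simp: F'_def norm_mult intro!: mult_right_mono le\<close>)
  also have "\<dots> = c * pnorm p F' (\<lambda>s. f (- g + s))"
    using assms(1,2) by (simp add: pnorm_mult)
  also have "pnorm p F' (\<lambda>s. f (- g + s)) = pnorm p ((\<lambda>s. - g + s) ` F') f"
    unfolding pnorm_def by (subst sum.reindex) (auto simp: inj_on_def)
  also have "c * \<dots> \<le> c * pnorm p E f"
    by (intro mult_left_mono pnorm_le_pnorm) (use * assms(1,2) in \<open>auto simp: F'_def\<close>)
  finally show "pnorm p F (\<lambda>s. \<Sum>t\<in>E. A s t * f t) \<le> c * pnorm p E f" .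
qed

subsection \<open>Schur multipliers of negative type\<close>

definition schur_contractive :: "real \<Rightarrow> ('a \<Rightarrow> 'b \<Rightarrow> real) \<Rightarrow> bool" where
  "schur_contractive p k \<longleftrightarrow>
     (\<forall>A c. matrix_bound p A c \<longrightarrow> matrix_bound p (\<lambda>s t. complex_of_real (k s t) * A s t) c)"

lemma schur_contractiveI:
  "(\<And>A c. matrix_bound p A c \<Longrightarrow> matrix_bound p (\<lambda>s t. complex_of_real (k s t) * A s t) c)
    \<Longrightarrow> schur_contractive p k"
  by (simp add: schur_contractive_def)

lemma schur_contractiveD:
  "schur_contractive p k \<Longrightarrow> matrix_bound p A c
    \<Longrightarrow> matrix_bound p (\<lambda>s t. complex_of_real (k s t) * A s t) c"
  by (simp add: schur_contractive_def)

text \<open>The cosine is the average of two characters, and each acts as conjugation by the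
  diagonal unitary \<open>cis (v s)\<close> or its inverse.\<close>

lemma schur_contractive_cos:
  assumes "p > 1"
  shows "schur_contractive p (\<lambda>s t. cos (v s - v t))"
proof (rule schur_contractiveI)
  fix A :: "'a \<Rightarrow> 'a \<Rightarrow> complex" and c assume A: "matrix_bound p A c"
  have "matrix_bound p (\<lambda>s t. (1/2) * (cis (v s) * cis (- v t) * A s t + cis (- v s) * cis (v t) * A s t))
      (norm (1/2 :: complex) * (c + c))"
    by (intro matrix_bound_mult matrix_bound_add matrix_bound_unimodular A) (use assms in auto)
  moreover have "(1/2) * (cis (v s) * cis (- v t) * A s t + cis (- v s) * cis (v t) * A s t)
      = complex_of_real (cos (v s - v t)) * A s t" for s t
  proof -
    have "cis (v s) * cis (- v t) + cis (- v s) * cis (v t) = 2 * complex_of_real (cos (v s - v t))"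
      unfolding cis_mult by (simp add: complex_eq_iff cos_diff sin_diff cos_add sin_add)
    then have "(cis (v s) * cis (- v t) + cis (- v s) * cis (v t)) * A s t
        = 2 * complex_of_real (cos (v s - v t)) * A s t"
      by (rule arg_cong)
    then show ?thesis by (simp add: distrib_right)
  qed
  moreover have "norm (1/2 :: complex) * (c + c) = c" by (simp add: norm_divide)
  ultimately show "matrix_bound p (\<lambda>s t. complex_of_real (cos (v s - v t)) * A s t) c"
    by (simp only:)
qed

lemma schur_contractive_one: "schur_contractive p (\<lambda>_ _. 1)"
  by (simp add: schur_contractive_def)

lemma schur_contractive_mult:
  fixes k :: "'a \<Rightarrow> 'b \<Rightarrow> real"
  assumes "schur_contractive p k" "schur_contractive p k'"
  shows "schur_contractive p (\<lambda>s t. k s t * k' s t)"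
proof (rule schur_contractiveI)
  fix A :: "'a \<Rightarrow> 'b \<Rightarrow> complex" and c assume "matrix_bound p A c"
  from schur_contractiveD[OF assms(1) schur_contractiveD[OF assms(2) this]]
  show "matrix_bound p (\<lambda>s t. complex_of_real (k s t * k' s t) * A s t) c"
    by (simp only: of_real_mult mult.assoc)
qed

lemma schur_contractive_prod:
  assumes "\<And>i. i \<in> I \<Longrightarrow> schur_contractive p (k i)"
  shows "schur_contractive p (\<lambda>s t. \<Prod>i\<in>I. k i s t)"
  using assms
  by (induction I rule: infinite_finite_induct)
    (auto intro: schur_contractive_one schur_contractive_mult)

lemma schur_contractive_limit:
  fixes k :: "nat \<Rightarrow> 'a \<Rightarrow> 'b \<Rightarrow> real"
  assumes "p > 0" "\<And>n. schur_contractive p (k n)" "\<And>s t. (\<lambda>n. k n s t) \<longlonglongrightarrow> k' s t"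
  shows "schur_contractive p k'"
proof (rule schur_contractiveI)
  fix A :: "'a \<Rightarrow> 'b \<Rightarrow> complex" and c assume A: "matrix_bound p A c"
  have lim: "(\<lambda>n. complex_of_real (k n s t) * A s t) \<longlonglongrightarrow> complex_of_real (k' s t) * A s t" for s t
    by (intro tendsto_intros assms(3))
  show "matrix_bound p (\<lambda>s t. complex_of_real (k' s t) * A s t) c"
    by (rule matrix_bound_limit[OF assms(1) schur_contractiveD[OF assms(2) A] lim])
qed

text \<open>This is the central limit theorem for random signs: the left side is the characteristic
  function of a normalised sum of \<open>n\<close> of them.\<close>

lemma cos_power_tendsto_gaussian:
  fixes x :: real
  shows "(\<lambda>n. cos (x / sqrt (real n)) ^ n) \<longlonglongrightarrow> exp (- x\<^sup>2 / 2)"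
proof -
  have "((\<lambda>n. cos (x / sqrt (real n)) powr real n) \<longlongrightarrow> exp (- (x * x / 2))) sequentially"
    by real_asymp
  moreover have "(\<lambda>n. cos (x / sqrt (real n))) \<longlonglongrightarrow> 1"
    by real_asymp
  \<comment> \<open>The limit was computed for \<open>powr\<close>, which agrees with the natural
    power only where the base is positive.\<close>
  then have "\<forall>\<^sub>F n in sequentially. cos (x / sqrt (real n)) > 0"
    by (rule order_tendstoD) simp
  then have "\<forall>\<^sub>F n in sequentially. cos (x / sqrt (real n)) powr real n = cos (x / sqrt (real n)) ^ n"
    by eventually_elim (simp add: powr_realpow)
  ultimately have "(\<lambda>n. cos (x / sqrt (real n)) ^ n) \<longlonglongrightarrow> exp (- (x * x / 2))"
    by (simp cong: tendsto_cong)
  then show ?thesis by (simp add: power2_eq_square)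
qed

text \<open>Contractivity survives products and pointwise limits, so it passes from the cosine to
  the limit of its rescaled powers.\<close>

lemma schur_contractive_gaussian:
  assumes "p > 1"
  shows "schur_contractive p (\<lambda>s t. exp (- (v s - v t)\<^sup>2 / 2))"
proof (rule schur_contractive_limit)
  show "schur_contractive p (\<lambda>s t. cos ((v s - v t) / sqrt (real n)) ^ n)" for n
    using schur_contractive_prod[of "{..<n}" p "\<lambda>_ s t. cos (v s / sqrt (real n) - v t / sqrt (real n))"]
      schur_contractive_cos[OF assms, of "\<lambda>s. v s / sqrt (real n)"]
    by (simp add: diff_divide_distrib)
  show "(\<lambda>n. cos ((v s - v t) / sqrt (real n)) ^ n) \<longlonglongrightarrow> exp (- (v s - v t)\<^sup>2 / 2)" for s t
    by (rule cos_power_tendsto_gaussian)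
qed (use assms in auto)

section \<open>Gram representations and the Euclidean embedding of a negative type function\<close>

lemma sum_insert_quadratic_form:
  fixes K :: "'a \<Rightarrow> 'a \<Rightarrow> real"
  assumes "finite X" "x \<notin> X" "\<And>y. y \<in> X \<Longrightarrow> K y x = K x y"
  shows "(\<Sum>y\<in>insert x X. \<Sum>z\<in>insert x X. c y * c z * K y z)
    = (c x)\<^sup>2 * K x x + 2 * c x * (\<Sum>y\<in>X. c y * K x y) + (\<Sum>y\<in>X. \<Sum>z\<in>X. c y * c z * K y z)"
proof -
  have "(\<Sum>y\<in>X. c y * c x * K y x) = c x * (\<Sum>y\<in>X. c y * K x y)"
    unfolding sum_distrib_left using assms(3) by (intro sum.cong) auto
  moreover have "(\<Sum>y\<in>X. c x * c y * K x y) = c x * (\<Sum>y\<in>X. c y * K x y)"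
    by (simp add: sum_distrib_left mult.assoc)
  ultimately show ?thesis
    using assms(1,2) by (simp add: sum.distrib power2_eq_square)
qed

text \<open>Cholesky factorisation by induction: one point is eliminated, the Schur complement of
  \<open>K\<close> is represented on the remaining points, and one new coordinate accounts for the
  eliminated point.\<close>

lemma positive_semidefinite_gram:
  fixes K :: "'a \<Rightarrow> 'a \<Rightarrow> real"
  assumes "finite X" "\<And>x y. x \<in> X \<Longrightarrow> y \<in> X \<Longrightarrow> K x y = K y x"
    "\<And>c. (\<Sum>x\<in>X. \<Sum>y\<in>X. c x * c y * K x y) \<ge> 0"
  shows "\<exists>(n::nat) v. \<forall>x\<in>X. \<forall>y\<in>X. K x y = (\<Sum>m<n. v m x * v m y)"
  using assms
proof (induction X arbitrary: K rule: finite_induct)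
  case empty
  then show ?case by simp
next
  case (insert x X)
  note form = sum_insert_quadratic_form[of X x K, OF insert.hyps insert.prems(1)]
  have psd: "(c x)\<^sup>2 * K x x + 2 * c x * (\<Sum>y\<in>X. c y * K x y) + (\<Sum>y\<in>X. \<Sum>z\<in>X. c y * c z * K y z) \<ge> 0" for c
    using insert.prems(2)[of c] form by simp
  have Kxx: "K x x \<ge> 0"
  proof -
    define c :: "'a \<Rightarrow> real" where "c z = (if z = x then 1 else 0)" for z
    have "c y = 0" if "y \<in> X" for y
      using that insert.hyps by (auto simp: c_def)
    then show ?thesis using psd[of c] by (simp add: c_def)
  qed
  have K0: "K x y = 0" if "K x x = 0" "y \<in> X" for y
  proof (rule ccontr)
    assume "K x y \<noteq> 0"
    \<comment> \<open>The form at the coefficients \<open>a\<close> on \<open>x\<close> and 1 on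
      \<open>y\<close> is \<open>2 * a * K x y + K y y\<close>; this \<open>a\<close> makes it equal
      to -1.\<close>
    define a where "a = - (K y y + 1) / (2 * K x y)"
    define c where "c z = (if z = y then 1 else if z = x then a else 0)" for z
    have "y \<noteq> x" using that insert.hyps by auto
    have "(\<Sum>z\<in>X. c z * f z) = f y" for f :: "'a \<Rightarrow> real"
    proof -
      have "(\<Sum>z\<in>X. c z * f z) = (\<Sum>z\<in>X. if z = y then f y else 0)"
        by (rule sum.cong) (use insert.hyps in \<open>auto simp: c_def\<close>)
      then show ?thesis using that insert.hyps by simp
    qed
    then have "(\<Sum>z\<in>X. c z * K x z) = K x y" "(\<Sum>u\<in>X. \<Sum>z\<in>X. c u * c z * K u z) = K y y"
      by (simp_all add: mult.assoc flip: sum_distrib_left)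
    then have "2 * a * K x y + K y y \<ge> 0"
      using psd[of c] that \<open>y \<noteq> x\<close> by (simp add: c_def)
    moreover have "2 * a * K x y = - (K y y + 1)"
      using \<open>K x y \<noteq> 0\<close> by (simp add: a_def)
    ultimately show False by simp
  qed
  \<comment> \<open>The Schur complement. If \<open>K x x = 0\<close>, division by zero gives
    \<open>K' = K\<close>, which is right because \<open>K0\<close> says that the row of
    \<open>x\<close> vanishes.\<close>
  define K' where "K' y z = K y z - K x y * K x z / K x x" for y z
  have "\<exists>(n::nat) v. \<forall>y\<in>X. \<forall>z\<in>X. K' y z = (\<Sum>m<n. v m y * v m z)"
  proof (rule insert.IH)
    show "K' y z = K' z y" if "y \<in> X" "z \<in> X" for y z
      using that insert.prems(1) by (simp add: K'_def)
    fix c :: "'a \<Rightarrow> real"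
    define S where "S = (\<Sum>y\<in>X. c y * K x y)"
    \<comment> \<open>When \<open>K x x > 0\<close>, this coefficient at \<open>x\<close> minimises
      the quadratic form of \<open>K\<close>, and the minimum is the form of \<open>K'\<close> at
      \<open>c\<close>. When \<open>K x x = 0\<close>, it is 0.\<close>
    define c' where "c' = c(x := - S / K x x)"
    have c': "c' y = c y" if "y \<in> X" for y
      using that insert.hyps by (auto simp: c'_def)
    have "(\<Sum>y\<in>X. \<Sum>z\<in>X. c y * c z * K' y z) = (\<Sum>y\<in>X. \<Sum>z\<in>X. c y * c z * K y z) - S * S / K x x"
      unfolding S_def sum_product
      by (simp add: K'_def algebra_simps sum_subtractf sum_divide_distrib)
    also have "\<dots> = (c' x)\<^sup>2 * K x x + 2 * c' x * (\<Sum>y\<in>X. c' y * K x y) + (\<Sum>y\<in>X. \<Sum>z\<in>X. c' y * c' z * K y z)"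
      unfolding S_def[symmetric] using c'
      by (cases "K x x = 0") (simp_all add: S_def[symmetric] c'_def power2_eq_square)
    also have "\<dots> \<ge> 0" by (rule psd)
    finally show "(\<Sum>y\<in>X. \<Sum>z\<in>X. c y * c z * K' y z) \<ge> 0" .
  qed
  then obtain n :: nat and v where v: "\<And>y z. y \<in> X \<Longrightarrow> z \<in> X \<Longrightarrow> K' y z = (\<Sum>m<n. v m y * v m z)"
    by blast
  \<comment> \<open>The old coordinates must be set to 0 at \<open>x\<close>, where \<open>v\<close>
    is unconstrained; the new coordinate equals \<open>sqrt (K x x)\<close> there.\<close>
  define w where "w m z = (if m = n then K x z / sqrt (K x x) else if z = x then 0 else v m z)" for m z
  have w: "(\<Sum>m<Suc n. w m y * w m z)
      = (\<Sum>m<n. (if y = x then 0 else v m y) * (if z = x then 0 else v m z)) + K x y * K x z / K x x" for y z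
    using Kxx by (simp add: w_def)
  have "K y z = (\<Sum>m<Suc n. w m y * w m z)" if "y \<in> insert x X" "z \<in> insert x X" for y z
  proof (cases "y = x \<or> z = x")
    case True
    then show ?thesis
      unfolding w using that K0 insert.prems(1)[of x y] by (cases "K x x = 0") auto
  next
    case False
    then show ?thesis unfolding w using that v[of y z] by (simp add: K'_def)
  qed
  then show ?case by blast
qed

text \<open>Schoenberg's theorem on a finite set: a kernel of negative type becomes positive
  semidefinite after a base point, here the unit, is chosen, and its Gram vectors realise
  \<open>l (s - t)\<close> as squared distances.\<close>

lemma negative_type_gram:
  fixes l :: "'g::group_add \<Rightarrow> real"
  assumes l: "length_function l" and neg: "negative_type l" and "finite X"
  shows "\<exists>(n::nat) v. \<forall>s\<in>X. \<forall>t\<in>X. l (s - t) = (\<Sum>m<n. (v m s - v m t)\<^sup>2)"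
proof -
  have l0: "l 0 = 0" and lm: "l (- g) = l g" for g
    using l by (auto simp: length_function_def)
  have lsym: "l (s - t) = l (t - s)" for s t
    using lm[of "s - t"] by simp
  \<comment> \<open>By polarisation this has to be the inner product of the vectors for
    \<open>s\<close> and \<open>t\<close> when the unit is sent to the origin.\<close>
  define K where "K s t = (l s + l t - l (s - t)) / 2" for s t
  obtain h where h: "bij_betw h {..<card X} X"
    using \<open>finite X\<close> ex_bij_betw_nat_finite[of X] by (auto simp: atLeast0LessThan)
  have "\<exists>(n::nat) v. \<forall>s\<in>X. \<forall>t\<in>X. K s t = (\<Sum>m<n. v m s * v m t)"
  proof (rule positive_semidefinite_gram[OF \<open>finite X\<close>])
    show "K s t = K t s" for s t
      by (simp add: K_def lsym)
    fix c :: "'g \<Rightarrow> real"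
    define N where "N = card X"
    \<comment> \<open>One extra index \<open>N\<close>, carrying the unit, receives the coefficient
      that makes the total vanish; the form of \<open>K\<close> needs no such constraint on
      \<open>c\<close>.\<close>
    define a where "a i = (if i < N then c (h i) else - sum c X)" for i
    \<comment> \<open>Negative type is stated for \<open>- g i + g j\<close>, while the matrices
      depend on \<open>s - t\<close>. Inverting the points turns one difference into the
      other.\<close>
    define g where "g i = (if i < N then - h i else 0)" for i
    have re: "(\<Sum>i<N. f (h i)) = sum f X" for f :: "'g \<Rightarrow> real"
      using sum.reindex_bij_betw[OF h, of f] by (simp add: N_def)
    have "(\<Sum>i<Suc N. complex_of_real (a i)) = 0"
      using re[of c] by (simp add: a_def flip: of_real_sum)
    then have "(\<Sum>i<Suc N. \<Sum>j<Suc N. complex_of_real (a i) * cnj (complex_of_real (a j))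
        * complex_of_real (l (- g i + g j))) \<le> 0"
      using neg unfolding negative_type_def by blast
    then have "complex_of_real (\<Sum>i<Suc N. \<Sum>j<Suc N. a i * a j * l (- g i + g j)) \<le> complex_of_real 0"
      by (simp only: complex_cnj_complex_of_real of_real_mult of_real_sum of_real_0)
    then have "(\<Sum>i<Suc N. \<Sum>j<Suc N. a i * a j * l (- g i + g j)) \<le> 0"
      by (simp only: less_eq_complex_def Re_complex_of_real)
    also have "(\<Sum>i<Suc N. \<Sum>j<Suc N. a i * a j * l (- g i + g j))
        = (\<Sum>i<N. \<Sum>j<N. c (h i) * c (h j) * l (h i - h j)) - 2 * sum c X * (\<Sum>i<N. c (h i) * l (h i))"
      by (simp add: a_def g_def l0 lm sum.distrib sum_subtractf sum_distrib_left sum_negf algebra_simps)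
    also have "\<dots> = (\<Sum>s\<in>X. \<Sum>t\<in>X. c s * c t * l (s - t)) - 2 * sum c X * (\<Sum>s\<in>X. c s * l s)"
      using re[of "\<lambda>s. c s * l s"] re[of "\<lambda>s. \<Sum>j<N. c s * c (h j) * l (s - h j)"]
        re[of "\<lambda>t. c s * c t * l (s - t)" for s] by simp
    also have "\<dots> = - 2 * (\<Sum>s\<in>X. \<Sum>t\<in>X. c s * c t * K s t)"
    proof -
      have "(\<Sum>s\<in>X. \<Sum>t\<in>X. c s * c t * l s) = sum c X * (\<Sum>s\<in>X. c s * l s)"
        unfolding sum_product by (subst sum.swap) (simp add: mult_ac)
      moreover have "(\<Sum>s\<in>X. \<Sum>t\<in>X. c s * c t * l t) = sum c X * (\<Sum>s\<in>X. c s * l s)"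
        unfolding sum_product by (simp add: mult_ac)
      moreover have "2 * (\<Sum>s\<in>X. \<Sum>t\<in>X. c s * c t * K s t)
        = (\<Sum>s\<in>X. \<Sum>t\<in>X. c s * c t * l s) + (\<Sum>s\<in>X. \<Sum>t\<in>X. c s * c t * l t) - (\<Sum>s\<in>X. \<Sum>t\<in>X. c s * c t * l (s - t))"
        unfolding sum_distrib_left sum.distrib[symmetric] sum_subtractf[symmetric]
        by (intro sum.cong refl) (simp add: K_def field_simps)
      ultimately show ?thesis by simp
    qed
    finally show "(\<Sum>s\<in>X. \<Sum>t\<in>X. c s * c t * K s t) \<ge> 0" by simp
  qed
  then obtain n :: nat and v where v: "\<And>s t. s \<in> X \<Longrightarrow> t \<in> X \<Longrightarrow> K s t = (\<Sum>m<n. v m s * v m t)"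
    by blast
  have "l (s - t) = (\<Sum>m<n. (v m s - v m t)\<^sup>2)" if "s \<in> X" "t \<in> X" for s t
  proof -
    have "l (s - t) = K s s + K t t - 2 * K s t"
      by (simp add: K_def l0 field_simps)
    also have "\<dots> = (\<Sum>m<n. v m s * v m s + v m t * v m t - 2 * (v m s * v m t))"
      using that by (simp add: v sum.distrib sum_subtractf sum_distrib_left)
    also have "\<dots> = (\<Sum>m<n. (v m s - v m t)\<^sup>2)"
      by (rule sum.cong) (simp_all add: power2_eq_square algebra_simps)
    finally show ?thesis .
  qed
  then show ?thesis by blast
qed

text \<open>The embedding may depend on \<open>F\<close> and \<open>E\<close>, since a matrix bound
  is tested on one finite section at a time. The squared distance is a sum over coordinates, so its
  exponential is a product of one-dimensional Gaussians.\<close>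

lemma schur_contractive_negative_type:
  fixes l :: "'g::group_add \<Rightarrow> real"
  assumes "length_function l" "negative_type l" "p > 1" "\<tau> \<ge> 0"
  shows "schur_contractive p (\<lambda>s t. exp (- \<tau> * l (s - t)))"
proof (rule schur_contractiveI, rule matrix_boundI)
  fix A :: "'g \<Rightarrow> 'g \<Rightarrow> complex" and F E :: "'g set" and f :: "'g \<Rightarrow> complex" and c
  assume A: "matrix_bound p A c" and fin: "finite F" "finite E"
  then obtain n :: nat and v where
    v: "\<And>s t. s \<in> F \<union> E \<Longrightarrow> t \<in> F \<union> E \<Longrightarrow> l (s - t) = (\<Sum>m<n. (v m s - v m t)\<^sup>2)"
    using negative_type_gram[OF assms(1,2), of "F \<union> E"] by blast
  \<comment> \<open>The scaling \<open>sqrt (2 * \<tau>)\<close> compensates the factor 1/2 in the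
    Gaussian exponent.\<close>
  define k where "k s t = (\<Prod>m<n. exp (- (sqrt (2 * \<tau>) * v m s - sqrt (2 * \<tau>) * v m t)\<^sup>2 / 2))" for s t
  have "schur_contractive p k"
    unfolding k_def by (intro schur_contractive_prod schur_contractive_gaussian assms)
  from matrix_boundD[OF schur_contractiveD[OF this A] fin, of f]
  have "pnorm p F (\<lambda>s. \<Sum>t\<in>E. complex_of_real (k s t) * A s t * f t) \<le> c * pnorm p E f" .
  moreover have "k s t = exp (- \<tau> * l (s - t))" if "s \<in> F" "t \<in> E" for s t
  proof -
    have "- (sqrt (2 * \<tau>) * v m s - sqrt (2 * \<tau>) * v m t)\<^sup>2 / 2 = - \<tau> * (v m s - v m t)\<^sup>2" for m
      using assms(4) by (simp add: power_mult_distrib flip: right_diff_distrib)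
    then show ?thesis
      using that v[of s t] by (simp add: k_def exp_sum[symmetric] sum_distrib_left sum_negf)
  qed
  then have "pnorm p F (\<lambda>s. \<Sum>t\<in>E. complex_of_real (k s t) * A s t * f t)
      = pnorm p F (\<lambda>s. \<Sum>t\<in>E. complex_of_real (exp (- \<tau> * l (s - t))) * A s t * f t)"
    by (intro pnorm_cong arg_cong[where f = norm] sum.cong) auto
  ultimately show "pnorm p F (\<lambda>s. \<Sum>t\<in>E. complex_of_real (exp (- \<tau> * l (s - t))) * A s t * f t) \<le> c * pnorm p E f"
    by (simp only:)
qed

subsection \<open>Operators and their matrices\<close>

lemma lp_norm_nonneg [simp]: "0 \<le> lp_norm p f"
  by (simp add: lp_norm_def)

lemma lp_spaceI_pnorm:
  assumes "p > 0" "c \<ge> 0" and le: "\<And>F. finite F \<Longrightarrow> pnorm p F f \<le> c"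
  shows "f \<in> lp_space p" "lp_norm p f \<le> c"
proof -
  have le': "(\<Sum>x\<in>F. norm (f x) powr p) \<le> c powr p" if "finite F" for F
    using le[OF that] by (simp only: pnorm_le_iff[OF assms(1,2)])
  have summable: "(\<lambda>x. norm (f x) powr p) summable_on UNIV"
    by (rule nonneg_bdd_above_summable_on) (use le' in \<open>auto intro!: bdd_aboveI\<close>)
  then show "f \<in> lp_space p" by (simp add: lp_space_def)
  have "(\<Sum>\<^sub>\<infinity>x. norm (f x) powr p) \<le> c powr p"
    by (rule infsum_le_finite_sums[OF summable]) (rule le')
  then have "lp_norm p f \<le> (c powr p) powr (1 / p)"
    unfolding lp_norm_def using assms(1) by (intro powr_mono2) (auto intro: infsum_nonneg)
  then show "lp_norm p f \<le> c" using assms(1,2) by (simp add: powr_powr)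
qed

lemma pnorm_le_lp_norm:
  assumes "p > 0" "f \<in> lp_space p" "finite F"
  shows "pnorm p F f \<le> lp_norm p f"
  unfolding pnorm_def lp_norm_def
  by (intro powr_mono2 finite_sum_le_infsum) (use assms in \<open>auto simp: lp_space_def sum_nonneg\<close>)

lemma norm_le_lp_norm:
  assumes "p > 0" "f \<in> lp_space p"
  shows "norm (f x) \<le> lp_norm p f"
  using norm_le_pnorm[of p "{x}" x f] pnorm_le_lp_norm[OF assms, of "{x}"] assms by simp

lemma lp_space_dominated:
  assumes "p > 0" "g \<in> lp_space p" "C \<ge> 0" "\<And>x. norm (f x) \<le> C * norm (g x)"
  shows "f \<in> lp_space p" "lp_norm p f \<le> C * lp_norm p g"
proof -
  have "pnorm p F f \<le> C * lp_norm p g" if "finite F" for F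
  proof -
    have "pnorm p F f \<le> pnorm p F (\<lambda>x. complex_of_real C * g x)"
      using assms that by (intro pnorm_le_pnorm) (auto simp: norm_mult)
    also have "\<dots> = C * pnorm p F g" using assms by (simp add: pnorm_mult)
    also have "\<dots> \<le> C * lp_norm p g"
      by (intro mult_left_mono pnorm_le_lp_norm assms that)
    finally show ?thesis .
  qed
  then show "f \<in> lp_space p" "lp_norm p f \<le> C * lp_norm p g"
    using lp_spaceI_pnorm[of p "C * lp_norm p g" f] assms by auto
qed

lemma lp_space_add:
  assumes "p > 1" "f \<in> lp_space p" "g \<in> lp_space p"
  shows "(\<lambda>x. f x + g x) \<in> lp_space p"
    and "lp_norm p (\<lambda>x. f x + g x) \<le> lp_norm p f + lp_norm p g"
proof -
  have "pnorm p F (\<lambda>x. f x + g x) \<le> lp_norm p f + lp_norm p g" if "finite F" for F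
    by (rule order_trans[OF pnorm_triangle[OF assms(1)]])
      (intro add_mono pnorm_le_lp_norm, use assms that in auto)
  then show "(\<lambda>x. f x + g x) \<in> lp_space p" "lp_norm p (\<lambda>x. f x + g x) \<le> lp_norm p f + lp_norm p g"
    using lp_spaceI_pnorm[of p "lp_norm p f + lp_norm p g" "\<lambda>x. f x + g x"] assms by auto
qed

lemma lp_space_mult:
  assumes "p > 0" "f \<in> lp_space p"
  shows "(\<lambda>x. c * f x) \<in> lp_space p" and "lp_norm p (\<lambda>x. c * f x) \<le> norm c * lp_norm p f"
  using lp_space_dominated[OF assms, of "norm c" "\<lambda>x. c * f x"] by (auto simp: norm_mult)

lemma lp_space_finite_support:
  assumes "p > 0" "finite E" "\<And>x. x \<notin> E \<Longrightarrow> f x = 0"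
  shows "f \<in> lp_space p" "lp_norm p f = pnorm p E f"
proof -
  have le: "pnorm p F f \<le> pnorm p E f" if "finite F" for F
  proof -
    have "pnorm p F f = pnorm p (F \<inter> E) f"
    proof -
      have "(\<Sum>x\<in>F. norm (f x) powr p) = (\<Sum>x\<in>F \<inter> E. norm (f x) powr p)"
        by (rule sum.mono_neutral_right) (use assms that in auto)
      then show ?thesis by (simp only: pnorm_def)
    qed
    also have "\<dots> \<le> pnorm p E f"
      by (rule pnorm_le_pnorm) (use assms in auto)
    finally show ?thesis .
  qed
  show f: "f \<in> lp_space p"
    by (rule lp_spaceI_pnorm[OF assms(1) pnorm_nonneg le])
  have "lp_norm p f \<le> pnorm p E f"
    by (rule lp_spaceI_pnorm[OF assms(1) pnorm_nonneg le])
  with pnorm_le_lp_norm[OF assms(1) f assms(2)] show "lp_norm p f = pnorm p E f" by simp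
qed

lemma lp_space_zero: "(\<lambda>_. 0) \<in> lp_space p"
  by (simp add: lp_space_def)

lemma lp_norm_zero [simp]: "lp_norm p (\<lambda>_. 0) = 0"
  by (simp add: lp_norm_def)

lemma lp_space_indicator: "p > 0 \<Longrightarrow> indicator {t} \<in> lp_space p"
  by (rule lp_space_finite_support[of p "{t}"]) auto

lemma lp_space_reindex:
  assumes "bij h"
  shows "(\<lambda>x. f (h x)) \<in> lp_space p \<longleftrightarrow> f \<in> lp_space p" "lp_norm p (\<lambda>x. f (h x)) = lp_norm p f"
  using summable_on_reindex_bij_betw[OF assms, of "\<lambda>x. norm (f x) powr p"]
    infsum_reindex_bij_betw[OF assms, of "\<lambda>x. norm (f x) powr p"]
  by (simp_all add: lp_space_def lp_norm_def)

lemma lp_norm_tail_le: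
  assumes "p > 0" "f \<in> lp_space p" "e > 0"
  obtains E where "finite E" "\<And>F. finite F \<Longrightarrow> F \<inter> E = {} \<Longrightarrow> pnorm p F f \<le> e"
proof -
  let ?N = "\<Sum>\<^sub>\<infinity>x. norm (f x) powr p"
  have summable: "(\<lambda>x. norm (f x) powr p) summable_on UNIV"
    using assms by (simp add: lp_space_def)
  have "\<exists>E. finite E \<and> (\<Sum>x\<in>E. norm (f x) powr p) > ?N - e powr p"
  proof (rule ccontr)
    assume "\<not> ?thesis"
    then have "?N \<le> ?N - e powr p"
      by (intro infsum_le_finite_sums[OF summable]) (auto simp: not_less)
    then show False using assms by simp
  qed
  then obtain E where E: "finite E" "(\<Sum>x\<in>E. norm (f x) powr p) > ?N - e powr p"
    by blast
  show ?thesis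
  proof (rule that[OF E(1)])
    fix F assume F: "finite F" "F \<inter> E = {}"
    have "(\<Sum>x\<in>F. norm (f x) powr p) + (\<Sum>x\<in>E. norm (f x) powr p) = (\<Sum>x\<in>F \<union> E. norm (f x) powr p)"
      using F E by (simp add: sum.union_disjoint)
    also have "\<dots> \<le> ?N"
      using F E by (intro finite_sum_le_infsum[OF summable]) auto
    finally show "pnorm p F f \<le> e"
      using E(2) assms by (simp add: pnorm_le_iff)
  qed
qed

section \<open>Bounded operators and the operator norm\<close>

lemma bounded_operatorsD:
  assumes "T \<in> bounded_operators p"
  shows "f \<in> lp_space p \<Longrightarrow> T f \<in> lp_space p"
    and "f \<in> lp_space p \<Longrightarrow> h \<in> lp_space p \<Longrightarrow> T (\<lambda>x. f x + h x) = (\<lambda>x. T f x + T h x)"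
    and "f \<in> lp_space p \<Longrightarrow> T (\<lambda>x. c * f x) = (\<lambda>x. c * T f x)"
    and "\<exists>C. \<forall>f\<in>lp_space p. lp_norm p (T f) \<le> C * lp_norm p f"
    and "f \<notin> lp_space p \<Longrightarrow> T f = (\<lambda>x. 0)"
  using assms unfolding bounded_operators_def by blast+

lemma bounded_operatorsI:
  assumes "\<And>f. f \<in> lp_space p \<Longrightarrow> T f \<in> lp_space p"
    and "\<And>f h. f \<in> lp_space p \<Longrightarrow> h \<in> lp_space p \<Longrightarrow> T (\<lambda>x. f x + h x) = (\<lambda>x. T f x + T h x)"
    and "\<And>f c. f \<in> lp_space p \<Longrightarrow> T (\<lambda>x. c * f x) = (\<lambda>x. c * T f x)"
    and "\<And>f. f \<in> lp_space p \<Longrightarrow> lp_norm p (T f) \<le> C * lp_norm p f"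
    and "\<And>f. f \<notin> lp_space p \<Longrightarrow> T f = (\<lambda>x. 0)"
  shows "T \<in> bounded_operators p"
  using assms unfolding bounded_operators_def by blast

lemma op_norm_le:
  fixes T :: "('a \<Rightarrow> complex) \<Rightarrow> ('a \<Rightarrow> complex)"
  assumes "c \<ge> 0" "\<And>f. f \<in> lp_space p \<Longrightarrow> lp_norm p (T f) \<le> c * lp_norm p f"
  shows "op_norm p T \<le> c"
  unfolding op_norm_def
proof (rule cSUP_least)
  show "{f \<in> lp_space p. lp_norm p f \<le> 1} \<noteq> {}"
    using lp_space_zero[of p] by (auto intro!: exI[of _ "\<lambda>_. 0"])
  fix f :: "'a \<Rightarrow> complex" assume f: "f \<in> {f \<in> lp_space p. lp_norm p f \<le> 1}"
  then have "lp_norm p (T f) \<le> c * lp_norm p f" using assms by blast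
  also have "\<dots> \<le> c * 1" using f assms by (intro mult_left_mono) auto
  finally show "lp_norm p (T f) \<le> c" by simp
qed

lemma lp_norm_le_op_norm:
  fixes T :: "('a \<Rightarrow> complex) \<Rightarrow> ('a \<Rightarrow> complex)"
  assumes "p > 0" "T \<in> bounded_operators p" "f \<in> lp_space p"
  shows "lp_norm p (T f) \<le> op_norm p T * lp_norm p f"
proof -
  obtain C where C: "\<And>f. f \<in> lp_space p \<Longrightarrow> lp_norm p (T f) \<le> C * lp_norm p f"
    using bounded_operatorsD(4)[OF assms(2)] by blast
  have unit: "lp_norm p (T g) \<le> op_norm p T" if "g \<in> lp_space p" "lp_norm p g \<le> 1" for g
    unfolding op_norm_def
  proof (rule cSUP_upper)
    show "bdd_above ((\<lambda>f. lp_norm p (T f)) ` {f \<in> lp_space p. lp_norm p f \<le> 1})"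
    proof (rule bdd_aboveI2)
      fix f :: "'a \<Rightarrow> complex" assume "f \<in> {f \<in> lp_space p. lp_norm p f \<le> 1}"
      then have f: "f \<in> lp_space p" "lp_norm p f \<le> 1" by auto
      have "lp_norm p (T f) \<le> C * lp_norm p f" using C f by blast
      also have "\<dots> \<le> \<bar>C\<bar> * 1" using f by (intro mult_mono) auto
      finally show "lp_norm p (T f) \<le> \<bar>C\<bar>" by simp
    qed
  qed (use that in auto)
  show ?thesis
  proof (cases "lp_norm p f = 0")
    case True
    then show ?thesis using C[OF assms(3)] by simp
  next
    case False
    define a where "a = lp_norm p f"
    have a: "a > 0" using False by (simp add: a_def order_less_le)
    define g where "g = (\<lambda>x. complex_of_real (1 / a) * f x)"
    have g: "g \<in> lp_space p" "lp_norm p g \<le> 1"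
      using lp_space_mult[OF assms(1,3), of "complex_of_real (1 / a)"] a by (auto simp: g_def a_def norm_divide)
    have f: "f = (\<lambda>x. complex_of_real a * g x)"
      using a by (simp add: g_def)
    have "lp_norm p (T f) = lp_norm p (\<lambda>x. complex_of_real a * T g x)"
      using bounded_operatorsD(3)[OF assms(2) g(1), of "complex_of_real a"] f by simp
    also have "\<dots> \<le> a * lp_norm p (T g)"
      using lp_space_mult(2)[OF assms(1) bounded_operatorsD(1)[OF assms(2) g(1)], of "complex_of_real a"] a by simp
    also have "\<dots> \<le> a * op_norm p T" using unit[OF g] a by simp
    finally show ?thesis by (simp add: a_def mult.commute)
  qed
qed

lemma op_norm_nonneg:
  fixes T :: "('a \<Rightarrow> complex) \<Rightarrow> ('a \<Rightarrow> complex)"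
  assumes "p > 0" "T \<in> bounded_operators p"
  shows "0 \<le> op_norm p T"
proof -
  have "0 \<le> op_norm p T * lp_norm p (indicator {undefined} :: 'a \<Rightarrow> complex)"
    using lp_norm_le_op_norm[OF assms lp_space_indicator[OF assms(1)]] lp_norm_nonneg order_trans by blast
  moreover have "lp_norm p (indicator {undefined} :: 'a \<Rightarrow> complex) = 1"
    using lp_space_finite_support(2)[OF assms(1), of "{undefined}" "indicator {undefined} :: 'a \<Rightarrow> complex"] by (simp add: pnorm_def)
  ultimately show ?thesis by simp
qed

lemma bounded_operators_zero: "(\<lambda>f x. 0) \<in> bounded_operators p"
  by (rule bounded_operatorsI[where C = 0]) (auto simp: lp_space_zero)

lemma bounded_operators_add:
  assumes "p > 1" "S \<in> bounded_operators p" "T \<in> bounded_operators p"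
  shows "(\<lambda>f x. S f x + T f x) \<in> bounded_operators p"
    and "op_norm p (\<lambda>f x. S f x + T f x) \<le> op_norm p S + op_norm p T"
proof -
  have p: "p > 0" using assms by simp
  have le: "lp_norm p (\<lambda>x. S f x + T f x) \<le> (op_norm p S + op_norm p T) * lp_norm p f"
    if "f \<in> lp_space p" for f
    using lp_space_add(2)[OF assms(1) bounded_operatorsD(1)[OF assms(2) that] bounded_operatorsD(1)[OF assms(3) that]]
      lp_norm_le_op_norm[OF p assms(2) that] lp_norm_le_op_norm[OF p assms(3) that]
    by (simp add: distrib_right)
  show "(\<lambda>f x. S f x + T f x) \<in> bounded_operators p"
    by (rule bounded_operatorsI[OF _ _ _ le])
      (simp_all add: bounded_operatorsD[OF assms(2)] bounded_operatorsD[OF assms(3)] lp_space_add(1)[OF assms(1)]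
        algebra_simps)
  show "op_norm p (\<lambda>f x. S f x + T f x) \<le> op_norm p S + op_norm p T"
    by (rule op_norm_le[OF _ le]) (simp add: op_norm_nonneg[OF p] assms)
qed

lemma bounded_operators_mult:
  assumes "p > 0" "T \<in> bounded_operators p"
  shows "(\<lambda>f x. c * T f x) \<in> bounded_operators p"
    and "op_norm p (\<lambda>f x. c * T f x) \<le> norm c * op_norm p T"
proof -
  have le: "lp_norm p (\<lambda>x. c * T f x) \<le> (norm c * op_norm p T) * lp_norm p f" if f: "f \<in> lp_space p" for f
  proof -
    have "lp_norm p (\<lambda>x. c * T f x) \<le> norm c * lp_norm p (T f)"
      by (rule lp_space_mult(2)[OF assms(1) bounded_operatorsD(1)[OF assms(2) f]])
    also have "\<dots> \<le> norm c * (op_norm p T * lp_norm p f)"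
      by (intro mult_left_mono lp_norm_le_op_norm assms f) simp
    finally show ?thesis by (simp only: mult.assoc)
  qed
  show "(\<lambda>f x. c * T f x) \<in> bounded_operators p"
    by (rule bounded_operatorsI[OF _ _ _ le])
      (simp_all add: bounded_operatorsD[OF assms(2)] lp_space_mult(1)[OF assms(1)] algebra_simps)
  show "op_norm p (\<lambda>f x. c * T f x) \<le> norm c * op_norm p T"
    by (rule op_norm_le[OF _ le]) (simp add: op_norm_nonneg[OF assms])
qed

lemma bounded_operators_diff:
  assumes "p > 1" "S \<in> bounded_operators p" "T \<in> bounded_operators p"
  shows "(\<lambda>f x. S f x - T f x) \<in> bounded_operators p"
  using bounded_operators_add(1)[OF assms(1,2) bounded_operators_mult(1)[OF _ assms(3), of "-1"]] assms(1) by simp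

lemma bounded_operators_comp:
  assumes "p > 0" "S \<in> bounded_operators p" "T \<in> bounded_operators p"
  shows "S \<circ> T \<in> bounded_operators p" and "op_norm p (S \<circ> T) \<le> op_norm p S * op_norm p T"
proof -
  have le: "lp_norm p ((S \<circ> T) f) \<le> (op_norm p S * op_norm p T) * lp_norm p f" if f: "f \<in> lp_space p" for f
  proof -
    have "lp_norm p (S (T f)) \<le> op_norm p S * lp_norm p (T f)"
      by (rule lp_norm_le_op_norm[OF assms(1,2) bounded_operatorsD(1)[OF assms(3) f]])
    also have "\<dots> \<le> op_norm p S * (op_norm p T * lp_norm p f)"
      by (intro mult_left_mono lp_norm_le_op_norm assms f op_norm_nonneg)
    finally show ?thesis by (simp add: mult.assoc)
  qed
  \<comment> \<open>Outside \<open>lp_space p\<close> the inner operator returns the zero function,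
    and the composition has to vanish there too.\<close>
  have S0: "S (\<lambda>x. 0) = (\<lambda>x. 0)"
    using bounded_operatorsD(3)[OF assms(2) lp_space_zero, of 0] by simp
  show "S \<circ> T \<in> bounded_operators p"
    by (rule bounded_operatorsI[OF _ _ _ le])
      (simp_all add: bounded_operatorsD[OF assms(2)] bounded_operatorsD[OF assms(3)] S0)
  show "op_norm p (S \<circ> T) \<le> op_norm p S * op_norm p T"
    by (rule op_norm_le[OF _ le]) (simp add: op_norm_nonneg assms)
qed

lemma regular_bounded_operators:
  fixes g :: "'g::group_add"
  assumes "p > 1"
  shows "left_regular p g \<in> bounded_operators p" "right_regular p g \<in> bounded_operators p"
proof -
  have reindex: "(\<lambda>f. if f \<in> lp_space p then (\<lambda>t. f (h t)) else (\<lambda>t. 0)) \<in> bounded_operators p"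
    if "bij h" for h :: "'g \<Rightarrow> 'g"
    by (rule bounded_operatorsI[where C = 1])
      (use assms in \<open>simp_all add: lp_space_reindex[OF that] lp_space_add(1) lp_space_mult(1)\<close>)
  have "left_regular p g = (\<lambda>f. if f \<in> lp_space p then (\<lambda>t. f (- g + t)) else (\<lambda>t. 0))"
    "right_regular p g = (\<lambda>f. if f \<in> lp_space p then (\<lambda>t. f (t + g)) else (\<lambda>t. 0))"
    by (simp_all add: fun_eq_iff left_regular_def right_regular_def)
  moreover have "bij (\<lambda>t. - g + t)"
    by (rule bij_betw_byWitness[of _ "\<lambda>t. g + t"]) auto
  moreover have "bij (\<lambda>t. t + g)"
    by (rule bij_betw_byWitness[of _ "\<lambda>t. t - g"]) auto
  ultimately show "left_regular p g \<in> bounded_operators p" "right_regular p g \<in> bounded_operators p"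
    using reindex by simp_all
qed

lemma bounded_operators_sum:
  assumes "p > 1" "finite I" "\<And>i. i \<in> I \<Longrightarrow> T i \<in> bounded_operators p"
  shows "(\<lambda>f x. \<Sum>i\<in>I. T i f x) \<in> bounded_operators p"
  using assms(2,3)
  by (induction I rule: finite_induct) (auto intro!: bounded_operators_zero bounded_operators_add \<open>p > 1\<close>)

section \<open>The correspondence between an operator and its matrix\<close>

lemma bounded_operator_finite_support:
  fixes T :: "('a \<Rightarrow> complex) \<Rightarrow> ('a \<Rightarrow> complex)"
  assumes "p > 1" "T \<in> bounded_operators p" "finite E"
  shows "T (\<lambda>x. if x \<in> E then f x else 0) s = (\<Sum>t\<in>E. matrix_entry T s t * f t)"
  using assms(3)
proof (induction E arbitrary: s rule: finite_induct)
  case empty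
  show ?case
    using bounded_operatorsD(3)[OF assms(2) lp_space_zero, of 0] by simp
next
  case (insert t E)
  have p: "p > 0" using assms by simp
  have ind: "(\<lambda>x. f t * indicator {t} x) \<in> lp_space p"
    by (intro lp_space_mult lp_space_indicator p)
  have E: "(\<lambda>x. if x \<in> E then f x else 0) \<in> lp_space p"
    by (rule lp_space_finite_support[OF p insert.hyps(1)]) simp
  have "(\<lambda>x. if x \<in> insert t E then f x else 0) = (\<lambda>x. f t * indicator {t} x + (if x \<in> E then f x else 0))"
    using insert.hyps by (auto simp: indicator_def fun_eq_iff)
  then have "T (\<lambda>x. if x \<in> insert t E then f x else 0) s
      = f t * T (indicator {t}) s + T (\<lambda>x. if x \<in> E then f x else 0) s"
    by (simp only: bounded_operatorsD(2)[OF assms(2) ind E] bounded_operatorsD(3)[OF assms(2) lp_space_indicator[OF p]])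
  then show ?case
    using insert by (simp add: matrix_entry_def mult.commute)
qed

lemma matrix_bound_op_norm:
  fixes T :: "('a \<Rightarrow> complex) \<Rightarrow> ('a \<Rightarrow> complex)"
  assumes "p > 1" "T \<in> bounded_operators p"
  shows "matrix_bound p (matrix_entry T) (op_norm p T)"
proof (rule matrix_boundI)
  fix F E :: "'a set" and f :: "'a \<Rightarrow> complex" assume fin: "finite F" "finite E"
  have p: "p > 0" using assms by simp
  define h where "h x = (if x \<in> E then f x else 0)" for x
  have h: "h \<in> lp_space p" "lp_norm p h = pnorm p E h"
    using lp_space_finite_support[OF p fin(2), of h] by (auto simp: h_def)
  have "pnorm p F (\<lambda>s. \<Sum>t\<in>E. matrix_entry T s t * f t) = pnorm p F (T h)"
    unfolding h_def by (rule pnorm_cong) (simp add: bounded_operator_finite_support[OF assms fin(2)])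
  also have "\<dots> \<le> lp_norm p (T h)"
    by (intro pnorm_le_lp_norm p bounded_operatorsD(1)[OF assms(2)] h fin)
  also have "\<dots> \<le> op_norm p T * lp_norm p h"
    by (intro lp_norm_le_op_norm p assms h)
  also have "lp_norm p h = pnorm p E f"
    unfolding h(2) by (rule pnorm_cong) (simp add: h_def)
  finally show "pnorm p F (\<lambda>s. \<Sum>t\<in>E. matrix_entry T s t * f t) \<le> op_norm p T * pnorm p E f" .
qed

text \<open>Finitely supported functions are dense. The finite sections control a truncation of
  \<open>f\<close>, and the boundedness of \<open>T\<close>, with whatever norm, makes the
  contribution of the tail as small as desired.\<close>

lemma lp_norm_le_matrix_bound:
  fixes T :: "('a \<Rightarrow> complex) \<Rightarrow> ('a \<Rightarrow> complex)"
  assumes "p > 1" "T \<in> bounded_operators p" "matrix_bound p (matrix_entry T) c" "f \<in> lp_space p"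
  shows "lp_norm p (T f) \<le> c * lp_norm p f"
proof -
  have p: "p > 0" using assms by simp
  have c: "c \<ge> 0" by (rule matrix_bound_nonneg[OF assms(3) p])
  have K: "op_norm p T \<ge> 0" by (rule op_norm_nonneg[OF p assms(2)])
  have "pnorm p F (T f) \<le> c * lp_norm p f" if F: "finite F" for F
  proof (rule field_le_epsilon)
    fix e :: real assume e: "e > 0"
    \<comment> \<open>The summand 1 keeps the denominator positive even if \<open>T\<close> has norm
      0.\<close>
    obtain E where E: "finite E" "\<And>F. finite F \<Longrightarrow> F \<inter> E = {} \<Longrightarrow> pnorm p F f \<le> e / (op_norm p T + 1)"
      using lp_norm_tail_le[OF p assms(4), of "e / (op_norm p T + 1)"] e K by auto
    define h where "h x = (if x \<in> E then f x else 0)" for x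
    define k where "k x = (if x \<in> E then 0 else f x)" for x
    have h: "h \<in> lp_space p"
      by (rule lp_space_finite_support[OF p E(1)]) (simp add: h_def)
    have "pnorm p G k \<le> e / (op_norm p T + 1)" if "finite G" for G
    proof -
      have "(\<Sum>x\<in>G. norm (k x) powr p) = (\<Sum>x\<in>G - E. norm (f x) powr p)"
        by (rule sum.mono_neutral_cong_right) (use that in \<open>auto simp: k_def\<close>)
      then have "pnorm p G k = pnorm p (G - E) f" by (simp only: pnorm_def)
      also have "\<dots> \<le> e / (op_norm p T + 1)" by (rule E(2)) (use that in auto)
      finally show ?thesis .
    qed
    then have k: "k \<in> lp_space p" "lp_norm p k \<le> e / (op_norm p T + 1)"
      using lp_spaceI_pnorm[OF p, of "e / (op_norm p T + 1)" k] e K by auto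
    have "f = (\<lambda>x. h x + k x)" by (auto simp: h_def k_def)
    then have "T f = (\<lambda>x. T h x + T k x)"
      using bounded_operatorsD(2)[OF assms(2) h k(1)] by simp
    then have "pnorm p F (T f) \<le> pnorm p F (T h) + pnorm p F (T k)"
      using pnorm_triangle[OF assms(1)] by simp
    also have "pnorm p F (T h) \<le> c * lp_norm p f"
    proof -
      have "pnorm p F (T h) = pnorm p F (\<lambda>s. \<Sum>t\<in>E. matrix_entry T s t * f t)"
        unfolding h_def by (rule pnorm_cong) (simp add: bounded_operator_finite_support[OF assms(1,2) E(1)])
      also have "\<dots> \<le> c * pnorm p E f" by (rule matrix_boundD[OF assms(3) F E(1)])
      also have "\<dots> \<le> c * lp_norm p f"
        by (intro mult_left_mono pnorm_le_lp_norm p assms E c)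
      finally show ?thesis .
    qed
    also have "pnorm p F (T k) \<le> e"
    proof -
      have "pnorm p F (T k) \<le> lp_norm p (T k)"
        by (intro pnorm_le_lp_norm p bounded_operatorsD(1)[OF assms(2)] k F)
      also have "\<dots> \<le> op_norm p T * lp_norm p k"
        by (intro lp_norm_le_op_norm p assms k)
      also have "\<dots> \<le> (op_norm p T + 1) * (e / (op_norm p T + 1))"
        by (intro mult_mono k) (use K e in auto)
      also have "\<dots> = e" using K by simp
      finally show ?thesis .
    qed
    finally show "pnorm p F (T f) \<le> c * lp_norm p f + e" by simp
  qed
  then show ?thesis
    using lp_spaceI_pnorm(2)[OF p, of "c * lp_norm p f" "T f"] c by simp
qed

lemma op_norm_le_matrix_bound:
  assumes "p > 1" "T \<in> bounded_operators p" "matrix_bound p (matrix_entry T) c"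
  shows "op_norm p T \<le> c"
  by (intro op_norm_le lp_norm_le_matrix_bound assms matrix_bound_nonneg[OF assms(3)]) (use assms in auto)

lemma matrix_entry_diff: "matrix_entry (\<lambda>f x. S f x - T f x) = (\<lambda>s t. matrix_entry S s t - matrix_entry T s t)"
  by (simp add: matrix_entry_def fun_eq_iff)

text \<open>The difference has the zero matrix, which satisfies a matrix bound with constant 0, so
  the comparison of norms forces it to vanish.\<close>

lemma bounded_operators_eqI:
  assumes "p > 1" "S \<in> bounded_operators p" "T \<in> bounded_operators p" "matrix_entry S = matrix_entry T"
  shows "S = T"
proof (intro ext)
  fix f x
  have p: "p > 0" using assms by simp
  show "S f x = T f x"
  proof (cases "f \<in> lp_space p")
    case True
    let ?D = "\<lambda>f x. S f x - T f x"
    have D: "?D \<in> bounded_operators p"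
      by (rule bounded_operators_diff[OF assms(1-3)])
    have "matrix_bound p (matrix_entry ?D) 0"
      by (simp add: matrix_entry_diff assms(4) matrix_bound_zero)
    from lp_norm_le_matrix_bound[OF assms(1) D this True]
    have "norm (?D f x) \<le> 0"
      using norm_le_lp_norm[OF p bounded_operatorsD(1)[OF D True], of x] by (simp del: norm_le_zero_iff)
    then show ?thesis by simp
  next
    case False
    then show ?thesis
      using bounded_operatorsD(5)[OF assms(2)] bounded_operatorsD(5)[OF assms(3)] by simp
  qed
qed

subsection \<open>Rapid decay as a bound on convolution matrices\<close>

lemma left_convolution_bounded_operator:
  assumes "p > 1" "finite {g. a g \<noteq> 0}"
  shows "left_convolution p a \<in> bounded_operators p"
proof -
  have "(\<lambda>f x. \<Sum>g | a g \<noteq> 0. a g * left_regular p g f x) \<in> bounded_operators p"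
    by (intro bounded_operators_sum bounded_operators_mult regular_bounded_operators assms) (use assms in auto)
  then show ?thesis by (simp only: left_convolution_def[abs_def])
qed

lemma left_regular_indicator:
  assumes "p > 0"
  shows "left_regular p g (indicator {t}) s = (if s = g + t then 1 else 0)"
proof -
  have "- g + s = t \<longleftrightarrow> s = g + t"
    by (metis add_minus_cancel minus_add_cancel)
  then show ?thesis
    by (simp add: left_regular_def lp_space_indicator[OF assms] indicator_def)
qed

lemma matrix_entry_left_convolution:
  assumes "p > 0" "finite {g. a g \<noteq> 0}"
  shows "matrix_entry (left_convolution p a) s t = a (s - t)"
proof -
  have "matrix_entry (left_convolution p a) s t = (\<Sum>g | a g \<noteq> 0. if g = s - t then a (s - t) else 0)"
    unfolding matrix_entry_def left_convolution_def
    by (rule sum.cong) (auto simp: left_regular_indicator[OF assms(1)] eq_diff_eq)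
  also have "\<dots> = a (s - t)"
    using assms(2) by simp
  finally show ?thesis .
qed

text \<open>For \<open>p = r\<close> this is rapid decay written with matrices. The second exponent
  is independent because transposition changes \<open>p\<close> and leaves \<open>r\<close>
  alone.\<close>

definition convolution_bound :: "real \<Rightarrow> real \<Rightarrow> ('g::group_add \<Rightarrow> real) \<Rightarrow> real \<Rightarrow> real \<Rightarrow> bool" where
  "convolution_bound p r l C s \<longleftrightarrow>
     (\<forall>b G. finite G \<longrightarrow> (\<forall>g. g \<notin> G \<longrightarrow> b g = 0) \<longrightarrow>
        matrix_bound p (\<lambda>x y. b (x - y)) (C * pnorm r G (\<lambda>g. b g * complex_of_real ((1 + l g) powr s))))"

lemma convolution_boundI:
  assumes "\<And>b G. finite G \<Longrightarrow> (\<And>g. g \<notin> G \<Longrightarrow> b g = 0) \<Longrightarrow>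
    matrix_bound p (\<lambda>x y. b (x - y)) (C * pnorm r G (\<lambda>g. b g * complex_of_real ((1 + l g) powr s)))"
  shows "convolution_bound p r l C s"
  using assms by (simp add: convolution_bound_def)

lemma convolution_boundD:
  assumes "convolution_bound p r l C s" "finite G" "\<And>g. g \<notin> G \<Longrightarrow> b g = 0"
  shows "matrix_bound p (\<lambda>x y. b (x - y)) (C * pnorm r G (\<lambda>g. b g * complex_of_real ((1 + l g) powr s)))"
  using assms by (simp add: convolution_bound_def)

lemma property_RD_convolution_bound:
  assumes "p > 1" "property_RD p l"
  obtains C s where "C > 0" "s > 0" "convolution_bound p p l C s"
proof -
  obtain C s where C: "C > 0" "s > 0"
    and RD: "\<And>a. finite {g. a g \<noteq> 0} \<Longrightarrow> op_norm p (left_convolution p a)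
          \<le> C * lp_norm p (\<lambda>g. a g * complex_of_real ((1 + l g) powr s))"
    using assms(2) unfolding property_RD_def by blast
  have p: "p > 0" using assms(1) by simp
  have "convolution_bound p p l C s"
  proof (rule convolution_boundI)
    fix b :: "'a \<Rightarrow> complex" and G assume G: "finite G" "\<And>g. g \<notin> G \<Longrightarrow> b g = 0"
    have fin: "finite {g. b g \<noteq> 0}"
      by (rule finite_subset[OF _ G(1)]) (use G(2) in auto)
    have "matrix_bound p (matrix_entry (left_convolution p b)) (op_norm p (left_convolution p b))"
      by (rule matrix_bound_op_norm[OF assms(1) left_convolution_bounded_operator[OF assms(1) fin]])
    then have "matrix_bound p (\<lambda>x y. b (x - y)) (op_norm p (left_convolution p b))"
      by (simp add: matrix_entry_left_convolution[OF p fin, abs_def])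
    moreover have "lp_norm p (\<lambda>g. b g * complex_of_real ((1 + l g) powr s))
        = pnorm p G (\<lambda>g. b g * complex_of_real ((1 + l g) powr s))"
      by (rule lp_space_finite_support(2)[OF p G(1)]) (simp add: G(2))
    ultimately show "matrix_bound p (\<lambda>x y. b (x - y)) (C * pnorm p G (\<lambda>g. b g * complex_of_real ((1 + l g) powr s)))"
      using matrix_bound_mono RD[OF fin] by metis
  qed
  then show ?thesis using C that by blast
qed

text \<open>Transposing inverts the argument of the symbol, and the weighted norm does not notice
  since \<open>l\<close> is symmetric under inversion.\<close>

lemma convolution_bound_transpose:
  assumes pq: "p > 1" "q > 1" "1/p + 1/q = 1" and l: "length_function l"
    and bd: "convolution_bound p r l C s"
  shows "convolution_bound q r l C s"
proof (rule convolution_boundI)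
  fix b :: "'a \<Rightarrow> complex" and G assume G: "finite G" "\<And>g. g \<notin> G \<Longrightarrow> b g = 0"
  have lm: "l (- g) = l g" for g using l by (simp add: length_function_def)
  have "matrix_bound p (\<lambda>x y. b (- (x - y)))
      (C * pnorm r (uminus ` G) (\<lambda>g. b (- g) * complex_of_real ((1 + l g) powr s)))"
    by (rule convolution_boundD[OF bd]) (use G in force)+
  also have "pnorm r (uminus ` G) (\<lambda>g. b (- g) * complex_of_real ((1 + l g) powr s))
      = pnorm r G (\<lambda>g. b g * complex_of_real ((1 + l g) powr s))"
    unfolding pnorm_def by (subst sum.reindex) (auto simp: lm)
  finally have "matrix_bound q (\<lambda>x y. b (- (y - x))) (C * pnorm r G (\<lambda>g. b g * complex_of_real ((1 + l g) powr s)))"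
    by (rule matrix_bound_transpose[OF pq])
  then show "matrix_bound q (\<lambda>x y. b (x - y)) (C * pnorm r G (\<lambda>g. b g * complex_of_real ((1 + l g) powr s)))"
    by simp
qed

text \<open>Each term of the convolution is split between \<open>U\<close>, a convolution of p-th
  powers estimated in exponent 1, and \<open>V\<close>, a convolution of powers \<open>p/2\<close>
  estimated by rapid decay in exponent 2. Rapid decay enters only through \<open>V\<close>, and
  taking the p-th root of its contribution produces the new constant; the new weight exponent is
  explained at \<open>W\<close>.\<close>

lemma convolution_bound_interpolate:
  assumes l: "length_function l" and C: "C > 0" "s > 0"
    and bd: "convolution_bound 2 2 l C s" and p: "1 < p" "p < 2"
  shows "convolution_bound p p l (C powr (2 * (p - 1) / p)) (2 * s / p)"
proof (rule convolution_boundI, rule matrix_boundI)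
  fix b :: "'a \<Rightarrow> complex" and G F E :: "'a set" and f :: "'a \<Rightarrow> complex"
  assume G: "finite G" "\<And>g. g \<notin> G \<Longrightarrow> b g = 0" and fin: "finite F" "finite E"
  \<comment> \<open>\<open>W\<close> is at once the square of the weighted 2-norm of
    \<open>norm (b g) powr (p/2)\<close> with exponent \<open>s\<close> and the p-th power of the
    weighted p-norm of \<open>b\<close> with exponent \<open>2 * s / p\<close>.\<close>
  define W where "W = (\<Sum>g\<in>G. norm (b g) powr p * (1 + l g) powr (2 * s))"
  define N where "N = (\<Sum>t\<in>E. norm (f t) powr p)"
  define U where "U x = (\<Sum>t\<in>E. norm (b (x - t)) powr p * norm (f t) powr p)" for x
  define V where "V x = (\<Sum>t\<in>E. norm (b (x - t)) powr (p/2) * norm (f t) powr (p/2))" for x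
  have l1: "1 + l g \<ge> 1" for g using l by (simp add: length_function_def)
  have W0: "W \<ge> 0" and N0: "N \<ge> 0" and U0: "U x \<ge> 0" and V0: "V x \<ge> 0" for x
    by (auto simp: W_def N_def U_def V_def intro!: sum_nonneg)
  have pointwise: "norm (\<Sum>t\<in>E. b (x - t) * f t) powr p \<le> U x powr (2 - p) * (V x powr 2) powr (p - 1)" for x
  proof -
    have "norm (\<Sum>t\<in>E. b (x - t) * f t) \<le> (\<Sum>t\<in>E. norm (b (x - t)) * norm (f t))"
      by (rule order_trans[OF norm_sum]) (simp add: norm_mult)
    also have "\<dots> = (\<Sum>t\<in>E. (norm (b (x - t)) powr p * norm (f t) powr p) powr (2/p - 1)
        * (norm (b (x - t)) powr (p/2) * norm (f t) powr (p/2)) powr (2 - 2/p))"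
    proof (rule sum.cong)
      fix t
      \<comment> \<open>The exponents \<open>2/p - 1\<close> and \<open>2 - 2/p\<close> are
        determined by adding up to 1, as Hoelder requires, and by recombining the powers
        \<open>p\<close> and \<open>p/2\<close> to the first power.\<close>
      have split: "y = (y powr p) powr (2/p - 1) * (y powr (p/2)) powr (2 - 2/p)" if "y \<ge> 0" for y :: real
      proof -
        have "p * (2/p - 1) + p/2 * (2 - 2/p) = 1" using p by (simp add: field_simps)
        then show ?thesis using that by (simp add: powr_powr powr_add[symmetric])
      qed
      have "norm (b (x - t)) * norm (f t)
          = ((norm (b (x - t)) powr p) powr (2/p - 1) * (norm (b (x - t)) powr (p/2)) powr (2 - 2/p))
            * ((norm (f t) powr p) powr (2/p - 1) * (norm (f t) powr (p/2)) powr (2 - 2/p))"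
        by (rule arg_cong2[where f = "(*)"]) (rule split, rule norm_ge_zero)+
      also have "\<dots> = (norm (b (x - t)) powr p * norm (f t) powr p) powr (2/p - 1)
          * (norm (b (x - t)) powr (p/2) * norm (f t) powr (p/2)) powr (2 - 2/p)"
        by (simp only: powr_mult mult_ac)
      finally show "norm (b (x - t)) * norm (f t) = (norm (b (x - t)) powr p * norm (f t) powr p) powr (2/p - 1)
        * (norm (b (x - t)) powr (p/2) * norm (f t) powr (p/2)) powr (2 - 2/p)" .
    qed simp
    also have "\<dots> \<le> U x powr (2/p - 1) * V x powr (2 - 2/p)"
      unfolding U_def V_def by (rule sum_powr_mult_le) (use p in \<open>auto simp: field_simps\<close>)
    finally have "norm (\<Sum>t\<in>E. b (x - t) * f t) powr p \<le> (U x powr (2/p - 1) * V x powr (2 - 2/p)) powr p"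
      using p by (intro powr_mono2) auto
    also have "\<dots> = U x powr (2 - p) * (V x powr 2) powr (p - 1)"
    proof -
      have "(2/p - 1) * p = 2 - p" "(2 - 2/p) * p = 2 * (p - 1)"
        using p by (simp_all add: field_simps)
      then show ?thesis by (simp add: powr_mult powr_powr)
    qed
    finally show ?thesis .
  qed
  \<comment> \<open>Exponent 1: interchanging the sums leaves translates of the symbol, whose sum is
    at most \<open>W\<close> because the weight is at least 1.\<close>
  have sumU: "(\<Sum>x\<in>F. U x) \<le> W * N"
  proof -
    have "(\<Sum>x\<in>F. norm (b (x - t)) powr p) \<le> W" for t
    proof -
      have "(\<Sum>x\<in>F. norm (b (x - t)) powr p) = (\<Sum>g\<in>(\<lambda>x. x - t) ` F. norm (b g) powr p)"
        by (subst sum.reindex) (auto simp: inj_on_def)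
      also have "\<dots> = (\<Sum>g\<in>(\<lambda>x. x - t) ` F \<inter> G. norm (b g) powr p)"
        by (rule sum.mono_neutral_right) (use fin G in auto)
      also have "\<dots> \<le> (\<Sum>g\<in>G. norm (b g) powr p)"
        by (rule sum_mono2) (use G in auto)
      also have "\<dots> \<le> W"
        unfolding W_def
      proof (rule sum_mono)
        fix g
        have "1 \<le> (1 + l g) powr (2 * s)"
          using l1[of g] C by (intro ge_one_powr_ge_zero) auto
        then show "norm (b g) powr p \<le> norm (b g) powr p * (1 + l g) powr (2 * s)"
          by (simp add: mult_le_cancel_left1)
      qed
      finally show ?thesis .
    qed
    then have "(\<Sum>t\<in>E. (\<Sum>x\<in>F. norm (b (x - t)) powr p) * norm (f t) powr p) \<le> (\<Sum>t\<in>E. W * norm (f t) powr p)"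
      by (intro sum_mono mult_right_mono) auto
    moreover have "(\<Sum>x\<in>F. U x) = (\<Sum>t\<in>E. (\<Sum>x\<in>F. norm (b (x - t)) powr p) * norm (f t) powr p)"
      unfolding U_def by (subst sum.swap) (simp add: sum_distrib_right)
    ultimately show ?thesis by (simp add: N_def sum_distrib_left)
  qed
  \<comment> \<open>Exponent 2: rapid decay for the nonnegative functions \<open>b2\<close> and
    \<open>f2\<close>, with the resulting inequality squared.\<close>
  have sumV: "(\<Sum>x\<in>F. V x powr 2) \<le> C powr 2 * (W * N)"
  proof -
    define b2 where "b2 g = complex_of_real (norm (b g) powr (p/2))" for g
    define f2 where "f2 t = complex_of_real (norm (f t) powr (p/2))" for t
    have normV: "norm (\<Sum>t\<in>E. b2 (x - t) * f2 t) = V x" for x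
    proof -
      have "(\<Sum>t\<in>E. b2 (x - t) * f2 t) = complex_of_real (V x)"
        by (simp add: V_def b2_def f2_def)
      then show ?thesis using V0[of x] by simp
    qed
    have "pnorm 2 F (\<lambda>x. \<Sum>t\<in>E. b2 (x - t) * f2 t)
        \<le> C * pnorm 2 G (\<lambda>g. b2 g * complex_of_real ((1 + l g) powr s)) * pnorm 2 E f2"
      by (rule matrix_boundD[OF convolution_boundD[OF bd G(1)] fin]) (use G p in \<open>auto simp: b2_def\<close>)
    also have "pnorm 2 E f2 = N powr (1/2)"
      by (simp add: pnorm_def f2_def N_def powr_powr)
    also have "pnorm 2 G (\<lambda>g. b2 g * complex_of_real ((1 + l g) powr s)) = W powr (1/2)"
      using l1 by (simp add: pnorm_def b2_def W_def norm_mult powr_mult powr_powr mult.commute)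
    finally have "(\<Sum>x\<in>F. norm (\<Sum>t\<in>E. b2 (x - t) * f2 t) powr 2) \<le> (C * W powr (1/2) * N powr (1/2)) powr 2"
      using C by (subst (asm) pnorm_le_iff) auto
    also have "\<dots> = C powr 2 * (W * N)"
      using C W0 N0 by (simp add: powr_mult powr_powr del: powr_numeral)
    finally show ?thesis by (simp only: normV)
  qed
  have "(\<Sum>x\<in>F. norm (\<Sum>t\<in>E. b (x - t) * f t) powr p) \<le> (\<Sum>x\<in>F. U x powr (2 - p) * (V x powr 2) powr (p - 1))"
    by (intro sum_mono pointwise)
  \<comment> \<open>A second use of Hoelder, now over the rows, with weights \<open>2 - p\<close>
    and \<open>p - 1\<close>; their sum is 1, and both are positive exactly for
    \<open>1 < p < 2\<close>.\<close>
  also have "\<dots> \<le> (\<Sum>x\<in>F. U x) powr (2 - p) * (\<Sum>x\<in>F. V x powr 2) powr (p - 1)"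
    by (rule sum_powr_mult_le) (use p U0 in auto)
  also have "\<dots> \<le> (W * N) powr (2 - p) * (C powr 2 * (W * N)) powr (p - 1)"
    by (intro mult_mono powr_mono2 sumU sumV) (use p U0 in \<open>auto intro!: sum_nonneg\<close>)
  also have "\<dots> = C powr (2 * (p - 1)) * (W * N)"
  proof -
    have "(W * N) powr (2 - p) * (W * N) powr (p - 1) = W * N"
      using W0 N0 by (simp add: powr_add[symmetric])
    moreover have "(C powr 2 * (W * N)) powr (p - 1) = C powr (2 * (p - 1)) * (W * N) powr (p - 1)"
      using C W0 N0 by (simp only: powr_mult powr_powr)
    ultimately show ?thesis by (simp only: mult.left_commute)
  qed
  also have "\<dots> = (C powr (2 * (p - 1) / p) * W powr (1/p) * N powr (1/p)) powr p"
    using p W0 N0 by (simp add: powr_mult powr_powr)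
  finally have "pnorm p F (\<lambda>x. \<Sum>t\<in>E. b (x - t) * f t) \<le> C powr (2 * (p - 1) / p) * W powr (1/p) * N powr (1/p)"
    using p by (subst pnorm_le_iff) auto
  moreover have "pnorm p G (\<lambda>g. b g * complex_of_real ((1 + l g) powr (2 * s / p))) = W powr (1/p)"
    using l1 p by (simp add: pnorm_def W_def norm_mult powr_mult powr_powr)
  ultimately show "pnorm p F (\<lambda>x. \<Sum>t\<in>E. b (x - t) * f t)
      \<le> C powr (2 * (p - 1) / p) * pnorm p G (\<lambda>g. b g * complex_of_real ((1 + l g) powr (2 * s / p))) * pnorm p E f"
    by (simp add: pnorm_def N_def)
qed

subsection \<open>Approximation of invariant operators\<close>

text \<open>The function is stationary at \<open>1 + x = s / \<tau>\<close>, and the bound is its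
  value there. It follows from \<open>ln y \<le> y - 1\<close> at
  \<open>y = (1 + x) * \<tau> / s\<close>, even if the stationary point is negative.\<close>

lemma power_exp_bounded:
  fixes s \<tau> :: real
  assumes "s > 0" "\<tau> > 0"
  obtains D where "D \<ge> 0" "\<And>x. x \<ge> 0 \<Longrightarrow> exp (- \<tau> * x) * (1 + x) powr s \<le> D"
proof
  show "0 \<le> exp (s * ln (s / \<tau>) + \<tau> - s)" by simp
  fix x :: real assume x: "x \<ge> 0"
  have "ln ((1 + x) * \<tau> / s) \<le> (1 + x) * \<tau> / s - 1"
    by (rule ln_le_minus_one) (use assms x in simp)
  moreover have "ln ((1 + x) * \<tau> / s) = ln (1 + x) - ln (s / \<tau>)"
    using assms x by (simp add: ln_mult ln_div)
  ultimately have "s * ln (1 + x) \<le> s * (ln (s / \<tau>) + ((1 + x) * \<tau> / s - 1))"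
    using assms by (intro mult_left_mono) auto
  also have "\<dots> = s * ln (s / \<tau>) + (1 + x) * \<tau> - s"
    using assms by (simp add: field_simps)
  finally have "- \<tau> * x + s * ln (1 + x) \<le> s * ln (s / \<tau>) + \<tau> - s"
    by (simp add: algebra_simps)
  then show "exp (- \<tau> * x) * (1 + x) powr s \<le> exp (s * ln (s / \<tau>) + \<tau> - s)"
    using x by (simp add: powr_def flip: exp_add)
qed

section \<open>Finite propagation and invariance in terms of matrix entries\<close>

lemma proper_right_invariant_metric_ball:
  assumes "proper_right_invariant_metric d"
  shows "finite {g. d g 0 \<le> r}" "d s t = d (s - t) 0" "0 \<le> d s t"
proof -
  interpret Metric_space UNIV d
    using assms by (simp add: proper_right_invariant_metric_def)
  have "finite (mball 0 (r + 1))"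
    using assms by (simp add: proper_right_invariant_metric_def)
  then show "finite {g. d g 0 \<le> r}"
    by (rule rev_finite_subset) (auto simp: commute)
  have "d (s + - t) (t + - t) = d s t"
    using assms unfolding proper_right_invariant_metric_def by blast
  then show "d s t = d (s - t) 0" by simp
  show "0 \<le> d s t" by simp
qed

text \<open>By right invariance the distance depends on \<open>s - t\<close> alone, and by
  properness a bounded set of differences is finite. This removes the metric from the arguments that
  follow.\<close>

lemma propagation_finite_iff:
  fixes d :: "'g::group_add \<Rightarrow> 'g \<Rightarrow> real"
  assumes d: "proper_right_invariant_metric d"
  shows "propagation d T < \<infinity> \<longleftrightarrow> (\<exists>P. finite P \<and> (\<forall>s t. matrix_entry T s t \<noteq> 0 \<longrightarrow> s - t \<in> P))"
proof
  assume "propagation d T < \<infinity>"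
  then obtain r where r: "propagation d T = ennreal r" "r \<ge> 0"
    by (cases "propagation d T") auto
  have "s - t \<in> {g. d g 0 \<le> r}" if "matrix_entry T s t \<noteq> 0" for s t
  proof -
    have "ennreal (d s t) \<le> propagation d T"
      unfolding propagation_def by (rule SUP_upper2[of "(s, t)"]) (use that in auto)
    then have "d s t \<le> r" using r by simp
    then show ?thesis using proper_right_invariant_metric_ball(2)[OF d, of s t] by simp
  qed
  then show "\<exists>P. finite P \<and> (\<forall>s t. matrix_entry T s t \<noteq> 0 \<longrightarrow> s - t \<in> P)"
    using proper_right_invariant_metric_ball(1)[OF d] by blast
next
  assume "\<exists>P. finite P \<and> (\<forall>s t. matrix_entry T s t \<noteq> 0 \<longrightarrow> s - t \<in> P)"
  then obtain P where P: "finite P" "\<And>s t. matrix_entry T s t \<noteq> 0 \<Longrightarrow> s - t \<in> P" by blast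
  \<comment> \<open>The sum replaces the maximum, so the case of an empty \<open>P\<close> needs no
    separate treatment.\<close>
  have "propagation d T \<le> ennreal (\<Sum>g\<in>P. d g 0)"
    unfolding propagation_def
  proof (rule SUP_least, clarify)
    fix s t assume "matrix_entry T s t \<noteq> 0"
    then have "d (s - t) 0 \<le> (\<Sum>g\<in>P. d g 0)"
      by (intro member_le_sum P) (auto simp: proper_right_invariant_metric_ball(3)[OF d])
    then show "ennreal (d s t) \<le> ennreal (\<Sum>g\<in>P. d g 0)"
      using proper_right_invariant_metric_ball(2)[OF d, of s t] by (simp add: ennreal_leI)
  qed
  then show "propagation d T < \<infinity>"
    by (simp add: order_le_less_trans)
qed

lemma right_regular_indicator:
  assumes "p > 0"
  shows "right_regular p g (indicator {t}) = indicator {t - g}"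
  by (auto simp: right_regular_def lp_space_indicator[OF assms] fun_eq_iff indicator_def eq_diff_eq)

lemma matrix_entry_conjugate:
  assumes "p > 0" "T \<in> bounded_operators p"
  shows "matrix_entry (right_regular p g \<circ> T \<circ> right_regular p (- g)) s t = matrix_entry T (s + g) (t + g)"
  using bounded_operatorsD(1)[OF assms(2) lp_space_indicator[OF assms(1)]]
  by (simp add: matrix_entry_def right_regular_indicator[OF assms(1)]) (simp add: right_regular_def)

lemma closed_subalgebraD:
  assumes "closed_subalgebra p A"
  shows "(\<lambda>f x. 0) \<in> A"
    and "S \<in> A \<Longrightarrow> T \<in> A \<Longrightarrow> (\<lambda>f x. S f x + T f x) \<in> A"
    and "T \<in> A \<Longrightarrow> (\<lambda>f x. c * T f x) \<in> A"
    and "op_closure p A \<subseteq> A"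
  using assms by (simp_all add: closed_subalgebra_def)

lemma left_convolution_mem_closed_subalgebra:
  assumes M: "closed_subalgebra p M" "range (left_regular p) \<subseteq> M" and fin: "finite {g. a g \<noteq> 0}"
  shows "left_convolution p a \<in> M"
proof -
  have "(\<lambda>f t. \<Sum>g\<in>I. a g * left_regular p g f t) \<in> M" if "finite I" for I
    using that
  proof (induction I rule: finite_induct)
    case empty
    show ?case using closed_subalgebraD(1)[OF M(1)] by simp
  next
    case (insert g I)
    have "(\<lambda>f t. a g * left_regular p g f t) \<in> M"
      by (rule closed_subalgebraD(3)[OF M(1)]) (use M(2) in blast)
    then have "(\<lambda>f t. a g * left_regular p g f t + (\<Sum>g\<in>I. a g * left_regular p g f t)) \<in> M"
      by (rule closed_subalgebraD(2)[OF M(1) _ insert.IH])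
    then show ?case using insert.hyps by simp
  qed
  from this[OF fin] show ?thesis by (simp only: left_convolution_def[abs_def])
qed

text \<open>Finite propagation cuts the matrix into finitely many translates of the diagonal. On
  each the deviation is a scalar tending to 0 times entries bounded by \<open>K\<close>. No
  invariance is assumed of \<open>A\<close>: an operator of finite propagation close to an invariant
  one need not be invariant.\<close>

lemma matrix_bound_heat_deviation:
  fixes A :: "'g::group_add \<Rightarrow> 'g \<Rightarrow> complex" and l :: "'g \<Rightarrow> real"
  assumes "p > 1" and A: "matrix_bound p A K" and P: "finite P" "\<And>s t. A s t \<noteq> 0 \<Longrightarrow> s - t \<in> P"
    and e: "e > 0"
  obtains \<tau> where "\<tau> > 0"
    "matrix_bound p (\<lambda>s t. A s t - complex_of_real (exp (- \<tau> * l (s - t))) * A s t) e"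
proof -
  have p: "p > 0" using assms(1) by simp
  have "((\<lambda>\<tau>. \<Sum>g\<in>P. \<bar>1 - exp (- \<tau> * l g)\<bar> * K) \<longlongrightarrow> (\<Sum>g\<in>P. \<bar>1 - exp (- 0 * l g)\<bar> * K)) (at_right 0)"
    by (intro tendsto_intros)
  then have "((\<lambda>\<tau>. \<Sum>g\<in>P. \<bar>1 - exp (- \<tau> * l g)\<bar> * K) \<longlongrightarrow> 0) (at_right 0)"
    by simp
  then have "\<forall>\<^sub>F \<tau> in at_right 0. (\<Sum>g\<in>P. \<bar>1 - exp (- \<tau> * l g)\<bar> * K) < e"
    by (rule order_tendstoD) (rule e)
  then obtain b :: real where b: "b > 0" "\<And>\<tau>. \<tau> > 0 \<Longrightarrow> \<tau> < b \<Longrightarrow> (\<Sum>g\<in>P. \<bar>1 - exp (- \<tau> * l g)\<bar> * K) < e"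
    by (auto simp: eventually_at_right_field)
  define \<tau> where "\<tau> = b / 2"
  have \<tau>: "\<tau> > 0" "(\<Sum>g\<in>P. \<bar>1 - exp (- \<tau> * l g)\<bar> * K) < e"
    using b(1) by (simp add: \<tau>_def, intro b(2)) (simp_all add: \<tau>_def)
  have "matrix_bound p (\<lambda>s t. \<Sum>g\<in>P. if s - t = g then complex_of_real (1 - exp (- \<tau> * l g)) * A s t else 0)
      (\<Sum>g\<in>P. \<bar>1 - exp (- \<tau> * l g)\<bar> * K)"
  proof (intro matrix_bound_sum P assms(1))
    fix g
    have K: "norm (A s t) \<le> K" for s t
      by (rule matrix_bound_entry[OF A p])
    show "matrix_bound p (\<lambda>s t. if s - t = g then complex_of_real (1 - exp (- \<tau> * l g)) * A s t else 0)
        (\<bar>1 - exp (- \<tau> * l g)\<bar> * K)"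
    proof (rule matrix_bound_translate[OF p])
      show "0 \<le> \<bar>1 - exp (- \<tau> * l g)\<bar> * K"
        using matrix_bound_nonneg[OF A p] by simp
      show "s = g + t" if "(if s - t = g then complex_of_real (1 - exp (- \<tau> * l g)) * A s t else 0) \<noteq> 0" for s t
        using that by (auto simp: diff_eq_eq split: if_splits)
      show "norm (if s - t = g then complex_of_real (1 - exp (- \<tau> * l g)) * A s t else 0) \<le> \<bar>1 - exp (- \<tau> * l g)\<bar> * K" for s t
      proof (cases "s - t = g")
        case True
        then have "norm (if s - t = g then complex_of_real (1 - exp (- \<tau> * l g)) * A s t else 0)
            = \<bar>1 - exp (- \<tau> * l g)\<bar> * norm (A s t)"
          by (simp only: if_True norm_mult norm_of_real refl)
        then show ?thesis using K[of s t] by (simp add: mult_left_mono)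
      next
        case False
        with matrix_bound_nonneg[OF A p] show ?thesis by simp
      qed
    qed
  qed
  moreover have "(\<Sum>g\<in>P. if s - t = g then complex_of_real (1 - exp (- \<tau> * l g)) * A s t else 0)
      = A s t - complex_of_real (exp (- \<tau> * l (s - t))) * A s t" for s t
  proof -
    have "(\<Sum>g\<in>P. if s - t = g then complex_of_real (1 - exp (- \<tau> * l g)) * A s t else 0)
        = (if s - t \<in> P then complex_of_real (1 - exp (- \<tau> * l (s - t))) * A s t else 0)"
      using P(1) by simp
    then show ?thesis using P(2)[of s t] by (auto simp: algebra_simps)
  qed
  ultimately have "matrix_bound p (\<lambda>s t. A s t - complex_of_real (exp (- \<tau> * l (s - t))) * A s t)
      (\<Sum>g\<in>P. \<bar>1 - exp (- \<tau> * l g)\<bar> * K)"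
    by (simp only:)
  from matrix_bound_mono[OF this] \<tau> show ?thesis
    by (intro that[of \<tau>]) auto
qed

text \<open>This extends the convolution bound to symbols of infinite support. A finite section sees
  finitely many differences \<open>x - y\<close>, so there the symbol may be replaced by a finitely
  supported one.\<close>

lemma matrix_bound_convolution_tail:
  assumes bd: "convolution_bound p r l C s" and "C > 0"
    and tail: "\<And>F. finite F \<Longrightarrow> F \<inter> E = {} \<Longrightarrow> pnorm r F (\<lambda>g. b g * complex_of_real ((1 + l g) powr s)) \<le> e"
  shows "matrix_bound p (\<lambda>x y. if x - y \<in> E then 0 else b (x - y)) (C * e)"
proof (rule matrix_boundI)
  fix X Y :: "'a set" and f :: "'a \<Rightarrow> complex" assume fin: "finite X" "finite Y"
  define G where "G = (\<lambda>(x, y). x - y) ` (X \<times> Y) - E"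
  have G: "finite G" using fin by (simp add: G_def)
  define c where "c g = (if g \<in> G then b g else 0)" for g
  have "pnorm p X (\<lambda>x. \<Sum>y\<in>Y. (if x - y \<in> E then 0 else b (x - y)) * f y) = pnorm p X (\<lambda>x. \<Sum>y\<in>Y. c (x - y) * f y)"
    by (intro pnorm_cong arg_cong[where f = norm] sum.cong) (auto simp: c_def G_def)
  also have "\<dots> \<le> C * pnorm r G (\<lambda>g. c g * complex_of_real ((1 + l g) powr s)) * pnorm p Y f"
    by (rule matrix_boundD[OF convolution_boundD[OF bd G] fin]) (simp add: c_def)
  also have "pnorm r G (\<lambda>g. c g * complex_of_real ((1 + l g) powr s))
      = pnorm r G (\<lambda>g. b g * complex_of_real ((1 + l g) powr s))"
    by (rule pnorm_cong) (simp add: c_def)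
  also have "C * \<dots> * pnorm p Y f \<le> C * e * pnorm p Y f"
    using \<open>C > 0\<close> G by (intro mult_right_mono mult_left_mono tail) (auto simp: G_def)
  finally show "pnorm p X (\<lambda>x. \<Sum>y\<in>Y. (if x - y \<in> E then 0 else b (x - y)) * f y) \<le> C * e * pnorm p Y f" .
qed

text \<open>The algebra \<open>M\<close> is arbitrary because the reduced group algebra is an
  intersection of such algebras. The bound \<open>column\<close> places the symbol in the unweighted
  space of exponent \<open>r\<close>.\<close>

lemma invariant_operator_mem_closed_subalgebra:
  fixes l :: "'g::group_add \<Rightarrow> real" and d :: "'g \<Rightarrow> 'g \<Rightarrow> real"
  assumes "p > 1" "r > 0" and d: "proper_right_invariant_metric d"
    and l: "length_function l" "negative_type l"
    and bd: "C > 0" "s > 0" "convolution_bound p r l C s"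
    and T: "T \<in> invariant_uniform_Roe_algebra p d"
    and column: "\<And>F. finite F \<Longrightarrow> pnorm r F (\<lambda>g. matrix_entry T g 0) \<le> K"
    and M: "closed_subalgebra p M" "range (left_regular p) \<subseteq> M"
  shows "T \<in> M"
proof -
  have p: "p > 0" using assms(1) by simp
  have l0: "l g \<ge> 0" for g using l by (simp add: length_function_def)
  have TB: "T \<in> bounded_operators p"
    and Tapp: "\<And>e. e > 0 \<Longrightarrow> \<exists>S\<in>{S \<in> bounded_operators p. propagation d S < \<infinity>}. op_norm p (\<lambda>f x. T f x - S f x) < e"
    and Tinv: "\<And>g. right_regular p g \<circ> T \<circ> right_regular p (- g) = T"
    using T unfolding invariant_uniform_Roe_algebra_def uniform_Roe_algebra_def op_closure_def by blast+
  define a where "a g = matrix_entry T g 0" for g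
  \<comment> \<open>Invariance under the translation by \<open>- y\<close> moves column
    \<open>y\<close> to the column at the unit.\<close>
  have Ta: "matrix_entry T x y = a (x - y)" for x y
    using matrix_entry_conjugate[OF p TB, of "- y" x y] Tinv[of "- y"] by (simp add: a_def)
  have K0: "K \<ge> 0" using column[of "{}"] pnorm_nonneg order_trans by blast
  have aK: "a \<in> lp_space r"
    unfolding a_def by (rule lp_spaceI_pnorm(1)[OF assms(2) K0 column])
  have "T \<in> op_closure p M"
    unfolding op_closure_def
  proof (intro CollectI conjI TB allI impI)
    fix e :: real assume e: "e > 0"
    obtain S where S: "S \<in> bounded_operators p" "propagation d S < \<infinity>" "op_norm p (\<lambda>f x. T f x - S f x) < e / 5"
      using Tapp[of "e / 5"] e by auto
    obtain P where P: "finite P" "\<And>x y. matrix_entry S x y \<noteq> 0 \<Longrightarrow> x - y \<in> P"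
      using S(2) propagation_finite_iff[OF d] by blast
    obtain \<tau> where \<tau>: "\<tau> > 0"
      "matrix_bound p (\<lambda>x y. matrix_entry S x y - complex_of_real (exp (- \<tau> * l (x - y))) * matrix_entry S x y) (e / 5)"
      using matrix_bound_heat_deviation[OF assms(1) matrix_bound_op_norm[OF assms(1) S(1)] P, of "e / 5" l] e by auto
    define b where "b g = complex_of_real (exp (- \<tau> * l g)) * a g" for g
    obtain D where D: "D \<ge> 0" "\<And>x. x \<ge> 0 \<Longrightarrow> exp (- \<tau> * x) * (1 + x) powr s \<le> D"
      using power_exp_bounded[OF bd(2) \<tau>(1)] by blast
    \<comment> \<open>The heat factor beats the polynomial weight uniformly, so the weighted symbol
      is dominated by \<open>a\<close> and has small tails.\<close>
    have "(\<lambda>g. b g * complex_of_real ((1 + l g) powr s)) \<in> lp_space r"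
    proof (rule lp_space_dominated(1)[OF assms(2) aK D(1)])
      fix g
      have "norm (b g * complex_of_real ((1 + l g) powr s)) = (exp (- \<tau> * l g) * (1 + l g) powr s) * norm (a g)"
        by (simp add: b_def norm_mult)
      also have "\<dots> \<le> D * norm (a g)" by (intro mult_right_mono D l0) simp
      finally show "norm (b g * complex_of_real ((1 + l g) powr s)) \<le> D * norm (a g)" .
    qed
    then obtain E where E: "finite E"
      "\<And>F. finite F \<Longrightarrow> F \<inter> E = {} \<Longrightarrow> pnorm r F (\<lambda>g. b g * complex_of_real ((1 + l g) powr s)) \<le> e / (5 * C)"
      using lp_norm_tail_le[OF assms(2), of _ "e / (5 * C)"] e bd(1) by auto
    define c where "c g = (if g \<in> E then b g else 0)" for g
    have c: "finite {g. c g \<noteq> 0}"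
      by (rule finite_subset[OF _ E(1)]) (auto simp: c_def)
    let ?B = "left_convolution p c"
    have B: "?B \<in> M" by (rule left_convolution_mem_closed_subalgebra[OF M c])
    have BB: "?B \<in> bounded_operators p" by (rule left_convolution_bounded_operator[OF assms(1) c])
    define A where "A = matrix_entry T"
    define A' where "A' = matrix_entry S"
    have 1: "matrix_bound p (\<lambda>x y. A x y - A' x y) (e / 5)"
      using matrix_bound_mono[OF matrix_bound_op_norm[OF assms(1) bounded_operators_diff[OF assms(1) TB S(1)]]] S(3)
      by (simp add: matrix_entry_diff A_def A'_def)
    have 2: "matrix_bound p (\<lambda>x y. A' x y - complex_of_real (exp (- \<tau> * l (x - y))) * A' x y) (e / 5)"
      using \<tau>(2) by (simp add: A'_def)
    have 3: "matrix_bound p (\<lambda>x y. (-1) * (complex_of_real (exp (- \<tau> * l (x - y))) * (A x y - A' x y))) (norm (-1 :: complex) * (e / 5))"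
      using \<tau>(1) by (intro matrix_bound_mult schur_contractiveD[OF schur_contractive_negative_type[OF l assms(1)]] 1 p) simp
    have 4: "matrix_bound p (\<lambda>x y. if x - y \<in> E then 0 else b (x - y)) (C * (e / (5 * C)))"
      by (rule matrix_bound_convolution_tail[OF bd(3,1) E(2)])
    \<comment> \<open>With a subscript for heat multiplication this is T - S, S -
      S_\<open>\<tau>\<close>, S_\<open>\<tau>\<close> - T_\<open>\<tau>\<close> and
      T_\<open>\<tau>\<close> - B. The third term is controlled by applying contractivity to the
      first. Four terms of size \<open>e / 5\<close> leave room for a strict inequality.\<close>
    have sum: "matrix_bound p (\<lambda>x y. (A x y - A' x y)
        + (A' x y - complex_of_real (exp (- \<tau> * l (x - y))) * A' x y)
        + (-1) * (complex_of_real (exp (- \<tau> * l (x - y))) * (A x y - A' x y))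
        + (if x - y \<in> E then 0 else b (x - y)))
        (e / 5 + e / 5 + norm (-1 :: complex) * (e / 5) + C * (e / (5 * C)))"
      by (intro matrix_bound_add 1 2 3 4 assms(1))
    have entry: "(A x y - A' x y)
        + (A' x y - complex_of_real (exp (- \<tau> * l (x - y))) * A' x y)
        + (-1) * (complex_of_real (exp (- \<tau> * l (x - y))) * (A x y - A' x y))
        + (if x - y \<in> E then 0 else b (x - y)) = matrix_entry (\<lambda>f x. T f x - ?B f x) x y" for x y
      by (simp add: matrix_entry_diff matrix_entry_left_convolution[OF p c] A_def Ta b_def c_def algebra_simps)
    have "op_norm p (\<lambda>f x. T f x - ?B f x) \<le> e / 5 + e / 5 + norm (-1 :: complex) * (e / 5) + C * (e / (5 * C))"
      by (rule op_norm_le_matrix_bound[OF assms(1) bounded_operators_diff[OF assms(1) TB BB] sum[unfolded entry]])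
    also have "\<dots> < e" using e bd(1) by simp
    finally show "\<exists>S\<in>M. op_norm p (\<lambda>f x. T f x - S f x) < e" using B by blast
  qed
  then show ?thesis using closed_subalgebraD(4)[OF M(1)] by blast
qed

subsection \<open>The invariant uniform Roe algebra\<close>

lemma op_closureI:
  assumes "T \<in> bounded_operators p" "\<And>e. e > 0 \<Longrightarrow> \<exists>S\<in>A. op_norm p (\<lambda>f x. T f x - S f x) < e"
  shows "T \<in> op_closure p A"
  using assms by (simp add: op_closure_def)

lemma op_closureD:
  assumes "T \<in> op_closure p A"
  shows "T \<in> bounded_operators p" "e > 0 \<Longrightarrow> \<exists>S\<in>A. op_norm p (\<lambda>f x. T f x - S f x) < e"
  using assms by (simp_all add: op_closure_def)

lemma op_closure_mono: "A \<subseteq> B \<Longrightarrow> op_closure p A \<subseteq> op_closure p B"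
  unfolding op_closure_def by blast

lemma op_norm_zero_operator: "p > 0 \<Longrightarrow> op_norm p (\<lambda>f x. 0) = 0"
  by (intro antisym op_norm_le op_norm_nonneg bounded_operators_zero) auto

lemma op_closure_superset:
  assumes "p > 0" "A \<subseteq> bounded_operators p"
  shows "A \<subseteq> op_closure p A"
proof
  fix T assume "T \<in> A"
  then show "T \<in> op_closure p A"
    using assms by (intro op_closureI bexI[of _ T]) (auto simp: op_norm_zero_operator)
qed

lemma op_closure_idem:
  assumes "p > 1" "A \<subseteq> bounded_operators p"
  shows "op_closure p (op_closure p A) \<subseteq> op_closure p A"
proof
  fix T assume T: "T \<in> op_closure p (op_closure p A)"
  show "T \<in> op_closure p A"
  proof (rule op_closureI[OF op_closureD(1)[OF T]])
    fix e :: real assume e: "e > 0"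
    obtain S where S: "S \<in> op_closure p A" "op_norm p (\<lambda>f x. T f x - S f x) < e / 2"
      using op_closureD(2)[OF T, of "e / 2"] e by auto
    obtain R where R: "R \<in> A" "op_norm p (\<lambda>f x. S f x - R f x) < e / 2"
      using op_closureD(2)[OF S(1), of "e / 2"] e by auto
    have "op_norm p (\<lambda>f x. (T f x - S f x) + (S f x - R f x))
        \<le> op_norm p (\<lambda>f x. T f x - S f x) + op_norm p (\<lambda>f x. S f x - R f x)"
      by (intro bounded_operators_add(2) bounded_operators_diff assms(1) op_closureD(1)[OF T] op_closureD(1)[OF S(1)])
        (use R assms in auto)
    then show "\<exists>S\<in>A. op_norm p (\<lambda>f x. T f x - S f x) < e"
      using S R by (intro bexI[of _ R]) auto
  qed
qed

lemma op_closure_add: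
  assumes "p > 1" "A \<subseteq> bounded_operators p"
    and add: "\<And>S T. S \<in> A \<Longrightarrow> T \<in> A \<Longrightarrow> (\<lambda>f x. S f x + T f x) \<in> A"
    and S: "S \<in> op_closure p A" and T: "T \<in> op_closure p A"
  shows "(\<lambda>f x. S f x + T f x) \<in> op_closure p A"
proof (rule op_closureI)
  note SB = op_closureD(1)[OF S] and TB = op_closureD(1)[OF T]
  show "(\<lambda>f x. S f x + T f x) \<in> bounded_operators p"
    by (rule bounded_operators_add(1)[OF assms(1) SB TB])
  fix e :: real assume e: "e > 0"
  obtain S' where S': "S' \<in> A" "op_norm p (\<lambda>f x. S f x - S' f x) < e / 2"
    using op_closureD(2)[OF S, of "e / 2"] e by auto
  obtain T' where T': "T' \<in> A" "op_norm p (\<lambda>f x. T f x - T' f x) < e / 2"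
    using op_closureD(2)[OF T, of "e / 2"] e by auto
  have "op_norm p (\<lambda>f x. (S f x - S' f x) + (T f x - T' f x))
      \<le> op_norm p (\<lambda>f x. S f x - S' f x) + op_norm p (\<lambda>f x. T f x - T' f x)"
    by (intro bounded_operators_add(2) bounded_operators_diff assms(1) SB TB) (use S' T' assms in auto)
  also have "\<dots> < e" using S' T' by simp
  finally have lt: "op_norm p (\<lambda>f x. (S f x + T f x) - (S' f x + T' f x)) < e"
    by (simp add: algebra_simps)
  show "\<exists>R\<in>A. op_norm p (\<lambda>f x. (S f x + T f x) - R f x) < e"
    by (rule bexI[OF _ add[OF S'(1) T'(1)]]) (rule lt)
qed

lemma op_closure_mult:
  assumes "p > 1" "A \<subseteq> bounded_operators p"
    and mult: "\<And>T. T \<in> A \<Longrightarrow> (\<lambda>f x. c * T f x) \<in> A"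
    and T: "T \<in> op_closure p A"
  shows "(\<lambda>f x. c * T f x) \<in> op_closure p A"
proof (rule op_closureI)
  note TB = op_closureD(1)[OF T]
  have p: "p > 0" using assms(1) by simp
  show "(\<lambda>f x. c * T f x) \<in> bounded_operators p"
    by (rule bounded_operators_mult(1)[OF p TB])
  fix e :: real assume e: "e > 0"
  have c: "norm c + 1 > 0" by (simp add: add_nonneg_pos)
  obtain T' where T': "T' \<in> A" "op_norm p (\<lambda>f x. T f x - T' f x) < e / (norm c + 1)"
    using op_closureD(2)[OF T, of "e / (norm c + 1)"] e c by auto
  have D: "(\<lambda>f x. T f x - T' f x) \<in> bounded_operators p"
    by (rule bounded_operators_diff[OF assms(1) TB]) (use T' assms in auto)
  have "op_norm p (\<lambda>f x. c * (T f x - T' f x)) \<le> norm c * op_norm p (\<lambda>f x. T f x - T' f x)"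
    by (rule bounded_operators_mult(2)[OF p D])
  also have "\<dots> \<le> norm c * (e / (norm c + 1))"
    using T' by (intro mult_left_mono) auto
  also have "\<dots> < e" using e c by (simp add: divide_simps)
  finally have lt: "op_norm p (\<lambda>f x. c * T f x - c * T' f x) < e"
    by (simp add: right_diff_distrib)
  show "\<exists>R\<in>A. op_norm p (\<lambda>f x. c * T f x - R f x) < e"
    by (rule bexI[OF _ mult[OF T'(1)]]) (rule lt)
qed

lemma bounded_operators_apply_diff:
  assumes "p > 1" "T \<in> bounded_operators p" "f \<in> lp_space p" "h \<in> lp_space p"
  shows "T (\<lambda>x. f x - h x) = (\<lambda>x. T f x - T h x)"
proof -
  have p: "p > 0" using assms(1) by simp
  have "T (\<lambda>x. f x + (-1) * h x) = (\<lambda>x. T f x + T (\<lambda>x. (-1) * h x) x)"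
    by (rule bounded_operatorsD(2)[OF assms(2,3) lp_space_mult(1)[OF p assms(4)]])
  also have "T (\<lambda>x. (-1) * h x) = (\<lambda>x. (-1) * T h x)"
    by (rule bounded_operatorsD(3)[OF assms(2,4)])
  finally show ?thesis by simp
qed

lemma bounded_operators_apply_zero:
  assumes "T \<in> bounded_operators p"
  shows "T (\<lambda>x. 0) = (\<lambda>x. 0)"
  using bounded_operatorsD(3)[OF assms lp_space_zero, of 0] by simp

text \<open>The difference of products is split as \<open>S\<close> after \<open>T - T'\<close> plus
  \<open>S - S'\<close> after \<open>T'\<close>.\<close>

lemma op_closure_comp:
  assumes "p > 1" "A \<subseteq> bounded_operators p"
    and comp: "\<And>S T. S \<in> A \<Longrightarrow> T \<in> A \<Longrightarrow> S \<circ> T \<in> A"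
    and S: "S \<in> op_closure p A" and T: "T \<in> op_closure p A"
  shows "S \<circ> T \<in> op_closure p A"
proof (rule op_closureI)
  note SB = op_closureD(1)[OF S] and TB = op_closureD(1)[OF T]
  have p: "p > 0" using assms(1) by simp
  show "S \<circ> T \<in> bounded_operators p"
    by (rule bounded_operators_comp(1)[OF p SB TB])
  fix e :: real assume e: "e > 0"
  define a where "a = op_norm p S"
  have a: "a \<ge> 0" unfolding a_def by (rule op_norm_nonneg[OF p SB])
  \<comment> \<open>\<open>T'\<close> is fixed before \<open>S'\<close> is chosen, since the
    accuracy required of \<open>S'\<close> depends on the norm of \<open>T'\<close>.\<close>
  obtain T' where T': "T' \<in> A" "op_norm p (\<lambda>f x. T f x - T' f x) < e / (2 * (a + 1))"
    using op_closureD(2)[OF T, of "e / (2 * (a + 1))"] e a by auto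
  have T'B: "T' \<in> bounded_operators p" using T' assms by auto
  define b where "b = op_norm p T'"
  have b: "b \<ge> 0" unfolding b_def by (rule op_norm_nonneg[OF p T'B])
  obtain S' where S': "S' \<in> A" "op_norm p (\<lambda>f x. S f x - S' f x) < e / (2 * (b + 1))"
    using op_closureD(2)[OF S, of "e / (2 * (b + 1))"] e b by auto
  have S'B: "S' \<in> bounded_operators p" using S' assms by auto
  let ?DS = "\<lambda>f x. S f x - S' f x" and ?DT = "\<lambda>f x. T f x - T' f x"
  have DS: "?DS \<in> bounded_operators p" and DT: "?DT \<in> bounded_operators p"
    by (intro bounded_operators_diff assms(1) SB TB S'B T'B)+
  have eq: "(\<lambda>f x. (S \<circ> T) f x - (S' \<circ> T') f x) = (\<lambda>f x. (S \<circ> ?DT) f x + (?DS \<circ> T') f x)"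
  proof (intro ext)
    fix f x
    show "(S \<circ> T) f x - (S' \<circ> T') f x = (S \<circ> ?DT) f x + (?DS \<circ> T') f x"
    proof (cases "f \<in> lp_space p")
      case True
      then show ?thesis
        using bounded_operators_apply_diff[OF assms(1) SB bounded_operatorsD(1)[OF TB True] bounded_operatorsD(1)[OF T'B True]]
        by simp
    next
      case False
      then show ?thesis
        using bounded_operatorsD(5)[OF TB False] bounded_operatorsD(5)[OF T'B False]
        by (simp add: bounded_operators_apply_zero[OF SB])
    qed
  qed
  have "op_norm p (\<lambda>f x. (S \<circ> T) f x - (S' \<circ> T') f x) \<le> op_norm p (S \<circ> ?DT) + op_norm p (?DS \<circ> T')"
    unfolding eq by (intro bounded_operators_add(2) bounded_operators_comp(1) assms(1) p SB DT DS T'B)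
  also have "\<dots> \<le> a * op_norm p ?DT + op_norm p ?DS * b"
    unfolding a_def b_def by (intro add_mono bounded_operators_comp(2) p SB DT DS T'B)
  also have "\<dots> \<le> a * (e / (2 * (a + 1))) + (e / (2 * (b + 1))) * b"
    using T' S' a b by (intro add_mono mult_left_mono mult_right_mono) auto
  also have "\<dots> < e"
  proof -
    have "a * (e / (2 * (a + 1))) < e / 2" "(e / (2 * (b + 1))) * b < e / 2"
      using a b e by (simp_all add: divide_simps)
    then have "a * (e / (2 * (a + 1))) + (e / (2 * (b + 1))) * b < e / 2 + e / 2"
      by (rule add_strict_mono)
    then show ?thesis by (simp only: field_sum_of_halves)
  qed
  finally have lt: "op_norm p (\<lambda>f x. (S \<circ> T) f x - (S' \<circ> T') f x) < e" .
  show "\<exists>R\<in>A. op_norm p (\<lambda>f x. (S \<circ> T) f x - R f x) < e"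
    by (rule bexI[OF _ comp[OF S'(1) T'(1)]]) (rule lt)
qed

lemma matrix_entry_comp:
  assumes "p > 1" "S \<in> bounded_operators p" "T \<in> bounded_operators p" "finite E"
    "\<And>u. u \<notin> E \<Longrightarrow> matrix_entry T u t = 0"
  shows "matrix_entry (S \<circ> T) s t = (\<Sum>u\<in>E. matrix_entry S s u * matrix_entry T u t)"
proof -
  have "T (indicator {t}) = (\<lambda>x. if x \<in> E then matrix_entry T x t else 0)"
  proof
    fix x show "T (indicator {t}) x = (if x \<in> E then matrix_entry T x t else 0)"
      using assms(5)[of x] by (simp add: matrix_entry_def)
  qed
  then have "matrix_entry (S \<circ> T) s t = S (\<lambda>x. if x \<in> E then matrix_entry T x t else 0) s"
    unfolding matrix_entry_def[of "S \<circ> T"] o_apply by (rule arg_cong)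
  also have "\<dots> = (\<Sum>u\<in>E. matrix_entry S s u * matrix_entry T u t)"
    by (rule bounded_operator_finite_support[OF assms(1,2,4)])
  finally show ?thesis .
qed

lemma finite_propagation_comp:
  fixes S T :: "('g::group_add \<Rightarrow> complex) \<Rightarrow> ('g \<Rightarrow> complex)"
  assumes "p > 1" "S \<in> bounded_operators p" "T \<in> bounded_operators p"
    and P: "\<And>s t. matrix_entry S s t \<noteq> 0 \<Longrightarrow> s - t \<in> P"
    and Q: "finite Q" "\<And>s t. matrix_entry T s t \<noteq> 0 \<Longrightarrow> s - t \<in> Q"
    and ne: "matrix_entry (S \<circ> T) s t \<noteq> 0"
  shows "s - t \<in> (\<lambda>(g, h). g + h) ` (P \<times> Q)"
proof -
  have "u \<in> (\<lambda>g. g + t) ` Q" if "matrix_entry T u t \<noteq> 0" for u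
    by (rule image_eqI[OF _ Q(2)[OF that]]) simp
  then have "matrix_entry (S \<circ> T) s t = (\<Sum>u\<in>(\<lambda>g. g + t) ` Q. matrix_entry S s u * matrix_entry T u t)"
    by (intro matrix_entry_comp[OF assms(1-3)]) (use Q in auto)
  with ne have "(\<Sum>u\<in>(\<lambda>g. g + t) ` Q. matrix_entry S s u * matrix_entry T u t) \<noteq> 0"
    by simp
  then obtain u where "matrix_entry S s u * matrix_entry T u t \<noteq> 0"
    by (meson sum.neutral)
  then have "(s - u, u - t) \<in> P \<times> Q" using P Q by auto
  moreover have "s - t = (s - u) + (u - t)" by (simp add: add_diff_eq)
  ultimately show ?thesis by force
qed

lemma closed_subalgebra_uniform_Roe_algebra:
  fixes d :: "'g::group_add \<Rightarrow> 'g \<Rightarrow> real"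
  assumes "p > 1" and d: "proper_right_invariant_metric d"
  shows "closed_subalgebra p (uniform_Roe_algebra p d)"
proof -
  define A where "A = {T \<in> bounded_operators p. propagation d T < \<infinity>}"
  have p: "p > 0" using assms(1) by simp
  have AI: "T \<in> A" if "T \<in> bounded_operators p" "finite P" "\<And>s t. matrix_entry T s t \<noteq> 0 \<Longrightarrow> s - t \<in> P" for T P
    unfolding A_def using that propagation_finite_iff[OF d, of T] by blast
  have AE: "\<exists>P. finite P \<and> (\<forall>s t. matrix_entry T s t \<noteq> 0 \<longrightarrow> s - t \<in> P)" if "T \<in> A" for T
    using that propagation_finite_iff[OF d, of T] unfolding A_def by blast
  have AB: "A \<subseteq> bounded_operators p" by (auto simp: A_def)
  have zero: "(\<lambda>f x. 0) \<in> A"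
    by (rule AI[of _ "{}"]) (auto simp: bounded_operators_zero matrix_entry_def)
  have add: "(\<lambda>f x. S f x + T f x) \<in> A" if S: "S \<in> A" and T: "T \<in> A" for S T
  proof -
    obtain P Q where PQ: "finite P" "\<And>s t. matrix_entry S s t \<noteq> 0 \<Longrightarrow> s - t \<in> P"
      "finite Q" "\<And>s t. matrix_entry T s t \<noteq> 0 \<Longrightarrow> s - t \<in> Q"
      using AE[OF S] AE[OF T] by blast
    show ?thesis
    proof (rule AI)
      show "finite (P \<union> Q)" using PQ by simp
      show "s - t \<in> P \<union> Q" if "matrix_entry (\<lambda>f x. S f x + T f x) s t \<noteq> 0" for s t
        using that PQ(2)[of s t] PQ(4)[of s t]
        by (cases "matrix_entry S s t = 0") (auto simp: matrix_entry_def)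
    qed (use S T AB in \<open>auto intro: bounded_operators_add assms\<close>)
  qed
  have mult: "(\<lambda>f x. c * T f x) \<in> A" if T: "T \<in> A" for c T
  proof -
    obtain Q where Q: "finite Q" "\<And>s t. matrix_entry T s t \<noteq> 0 \<Longrightarrow> s - t \<in> Q"
      using AE[OF T] by blast
    show ?thesis
      by (rule AI[OF _ Q(1)]) (use T AB p Q(2) in \<open>auto intro: bounded_operators_mult simp: matrix_entry_def\<close>)
  qed
  have comp: "S \<circ> T \<in> A" if S: "S \<in> A" and T: "T \<in> A" for S T
  proof -
    obtain P Q where PQ: "finite P" "\<And>s t. matrix_entry S s t \<noteq> 0 \<Longrightarrow> s - t \<in> P"
      "finite Q" "\<And>s t. matrix_entry T s t \<noteq> 0 \<Longrightarrow> s - t \<in> Q"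
      using AE[OF S] AE[OF T] by blast
    have ST: "S \<in> bounded_operators p" "T \<in> bounded_operators p" using S T AB by auto
    show ?thesis
    proof (rule AI)
      show "S \<circ> T \<in> bounded_operators p" by (rule bounded_operators_comp(1)[OF p ST])
      show "finite ((\<lambda>(g, h). g + h) ` (P \<times> Q))" using PQ by simp
    qed (rule finite_propagation_comp[OF assms(1) ST PQ(2-4)])
  qed
  have R: "uniform_Roe_algebra p d = op_closure p A"
    by (simp add: uniform_Roe_algebra_def A_def)
  show ?thesis
    unfolding closed_subalgebra_def R
  proof (intro conjI ballI allI)
    show "op_closure p A \<subseteq> bounded_operators p"
      by (auto dest: op_closureD(1))
    show "(\<lambda>f x. 0) \<in> op_closure p A"
      by (rule subsetD[OF op_closure_superset[OF p AB] zero])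
    show "op_closure p (op_closure p A) \<subseteq> op_closure p A"
      by (rule op_closure_idem[OF assms(1) AB])
  qed (rule op_closure_add[OF assms(1) AB add] op_closure_mult[OF assms(1) AB mult]
      op_closure_comp[OF assms(1) AB comp]; assumption)+
qed

section \<open>Left translations and the fixed points of conjugation by right translations\<close>

lemma matrix_entry_left_regular:
  "p > 0 \<Longrightarrow> matrix_entry (left_regular p g) s t = (if s = g + t then 1 else 0)"
  by (simp add: matrix_entry_def left_regular_indicator)

lemma left_regular_mem_uniform_Roe_algebra:
  fixes d :: "'g::group_add \<Rightarrow> 'g \<Rightarrow> real"
  assumes "p > 1" and d: "proper_right_invariant_metric d"
  shows "left_regular p g \<in> uniform_Roe_algebra p d"
proof -
  have p: "p > 0" using assms(1) by simp
  have "propagation d (left_regular p g) < \<infinity>"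
    unfolding propagation_finite_iff[OF d]
    by (rule exI[of _ "{g}"]) (simp add: matrix_entry_left_regular[OF p])
  then have "left_regular p g \<in> {T \<in> bounded_operators p. propagation d T < \<infinity>}"
    using regular_bounded_operators(1)[OF assms(1)] by blast
  then show ?thesis
    unfolding uniform_Roe_algebra_def by (rule subsetD[OF op_closure_superset[OF p], rotated]) blast
qed

text \<open>In this form invariance is a family of linear equations between entries, which passes at
  once to sums, scalar multiples and norm limits.\<close>

lemma right_invariant_iff:
  fixes T :: "('g::group_add \<Rightarrow> complex) \<Rightarrow> ('g \<Rightarrow> complex)"
  assumes "p > 1" "T \<in> bounded_operators p"
  shows "(\<forall>g. right_regular p g \<circ> T \<circ> right_regular p (- g) = T)
    \<longleftrightarrow> (\<forall>g s t. matrix_entry T (s + g) (t + g) = matrix_entry T s t)"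
proof -
  have p: "p > 0" using assms(1) by simp
  have "right_regular p g \<circ> T \<circ> right_regular p (- g) = T
      \<longleftrightarrow> (\<forall>s t. matrix_entry T (s + g) (t + g) = matrix_entry T s t)" for g
  proof
    assume "right_regular p g \<circ> T \<circ> right_regular p (- g) = T"
    then show "\<forall>s t. matrix_entry T (s + g) (t + g) = matrix_entry T s t"
      using matrix_entry_conjugate[OF p assms(2), of g] by simp
  next
    assume "\<forall>s t. matrix_entry T (s + g) (t + g) = matrix_entry T s t"
    then show "right_regular p g \<circ> T \<circ> right_regular p (- g) = T"
      using matrix_entry_conjugate[OF p assms(2), of g]
      by (intro bounded_operators_eqI[OF assms(1)] bounded_operators_comp(1)[OF p]
          regular_bounded_operators(2) assms) (simp add: fun_eq_iff)
  qed
  then show ?thesis by blast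
qed

text \<open>Products are treated with operators because an entry of a product is in general an
  infinite sum. Inserting a right translation and its inverse between the factors reduces the claim
  to the invariance of each.\<close>

lemma right_invariant_comp:
  fixes S T :: "('g::group_add \<Rightarrow> complex) \<Rightarrow> ('g \<Rightarrow> complex)"
  assumes "p > 1" "S \<in> bounded_operators p" "T \<in> bounded_operators p"
    and S: "right_regular p g \<circ> S \<circ> right_regular p (- g) = S"
    and T: "right_regular p g \<circ> T \<circ> right_regular p (- g) = T"
  shows "right_regular p g \<circ> (S \<circ> T) \<circ> right_regular p (- g) = S \<circ> T"
proof
  fix f
  define h where "h = T (right_regular p (- g) f)"
  have RB: "right_regular p (- g) f \<in> lp_space p"
    using bounded_operatorsD(1,5)[OF regular_bounded_operators(2)[OF assms(1), of "- g"], of f] lp_space_zero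
    by metis
  have h: "h \<in> lp_space p"
    unfolding h_def by (rule bounded_operatorsD(1)[OF assms(3) RB])
  have gh: "right_regular p g h \<in> lp_space p"
    by (rule bounded_operatorsD(1)[OF regular_bounded_operators(2)[OF assms(1)] h])
  have "right_regular p (- g) (right_regular p g h) = h"
    using h gh by (simp add: right_regular_def)
  then have "right_regular p g (S h) = S (right_regular p g h)"
    using fun_cong[OF S, of "right_regular p g h"] by simp
  also have "right_regular p g h = T f"
    using fun_cong[OF T, of f] by (simp add: h_def)
  finally show "(right_regular p g \<circ> (S \<circ> T) \<circ> right_regular p (- g)) f = (S \<circ> T) f"
    by (simp add: h_def)
qed

lemma closed_subalgebra_invariant_uniform_Roe_algebra:
  fixes d :: "'g::group_add \<Rightarrow> 'g \<Rightarrow> real"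
  assumes "p > 1" and d: "proper_right_invariant_metric d"
  shows "closed_subalgebra p (invariant_uniform_Roe_algebra p d)"
proof -
  let ?I = "invariant_uniform_Roe_algebra p d" and ?R = "uniform_Roe_algebra p d"
  have p: "p > 0" using assms(1) by simp
  have R: "closed_subalgebra p ?R" by (rule closed_subalgebra_uniform_Roe_algebra[OF assms])
  have RB: "?R \<subseteq> bounded_operators p" using R by (simp add: closed_subalgebra_def)
  have I: "T \<in> ?I \<longleftrightarrow> T \<in> ?R \<and> (\<forall>g s t. matrix_entry T (s + g) (t + g) = matrix_entry T s t)" for T
    using right_invariant_iff[OF assms(1), of T] RB unfolding invariant_uniform_Roe_algebra_def by blast
  have zero: "(\<lambda>f x. 0) \<in> ?I"
    unfolding I using closed_subalgebraD(1)[OF R] by (simp add: matrix_entry_def)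
  have add: "(\<lambda>f x. S f x + T f x) \<in> ?I" if "S \<in> ?I" "T \<in> ?I" for S T
    using that closed_subalgebraD(2)[OF R, of S T] unfolding I by (simp add: matrix_entry_def)
  have mult: "(\<lambda>f x. c * T f x) \<in> ?I" if "T \<in> ?I" for c T
    using that closed_subalgebraD(3)[OF R, of T c] unfolding I by (simp add: matrix_entry_def)
  have comp: "S \<circ> T \<in> ?I" if "S \<in> ?I" "T \<in> ?I" for S T
  proof -
    have ST: "S \<in> ?R" "T \<in> ?R" using that by (auto simp: invariant_uniform_Roe_algebra_def)
    then have "S \<circ> T \<in> ?R" using R unfolding closed_subalgebra_def by blast
    moreover have "right_regular p g \<circ> (S \<circ> T) \<circ> right_regular p (- g) = S \<circ> T" for g
      by (rule right_invariant_comp[OF assms(1)])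
        (use that ST RB in \<open>auto simp: invariant_uniform_Roe_algebra_def\<close>)
    ultimately show ?thesis by (simp add: invariant_uniform_Roe_algebra_def)
  qed
  have closed: "op_closure p ?I \<subseteq> ?I"
  proof
    fix T assume T: "T \<in> op_closure p ?I"
    note TB = op_closureD(1)[OF T]
    have "T \<in> ?R"
      using T op_closure_mono[of ?I ?R p] closed_subalgebraD(4)[OF R]
      by (auto simp: invariant_uniform_Roe_algebra_def)
    moreover have "matrix_entry T (s + g) (t + g) = matrix_entry T s t" for g s t
    proof -
      \<comment> \<open>Every entry of a difference is bounded by its operator norm, so an invariant
        approximant forces the two entries of \<open>T\<close> to be arbitrarily close.\<close>
      have "norm (matrix_entry T (s + g) (t + g) - matrix_entry T s t) \<le> 0 + e" if e: "e > 0" for e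
      proof -
        obtain S where S: "S \<in> ?I" "op_norm p (\<lambda>f x. T f x - S f x) < e / 2"
          using op_closureD(2)[OF T, of "e / 2"] e by auto
        then have SB: "S \<in> bounded_operators p" using RB unfolding I by auto
        have D: "norm (matrix_entry T x y - matrix_entry S x y) \<le> e / 2" for x y
          using matrix_bound_entry[OF matrix_bound_op_norm[OF assms(1) bounded_operators_diff[OF assms(1) TB SB]] p, of x y] S(2)
          by (simp add: matrix_entry_diff)
        have "norm (matrix_entry T (s + g) (t + g) - matrix_entry T s t)
            = norm ((matrix_entry T (s + g) (t + g) - matrix_entry S (s + g) (t + g)) - (matrix_entry T s t - matrix_entry S s t))"
          using S(1) unfolding I by simp
        also have "\<dots> \<le> e / 2 + e / 2"
          by (rule order_trans[OF norm_triangle_ineq4]) (intro add_mono D)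
        finally show ?thesis by simp
      qed
      then have "norm (matrix_entry T (s + g) (t + g) - matrix_entry T s t) \<le> 0"
        by (rule field_le_epsilon)
      then show ?thesis by simp
    qed
    ultimately show "T \<in> ?I" unfolding I by blast
  qed
  have "?I \<subseteq> bounded_operators p" using RB by (auto simp: invariant_uniform_Roe_algebra_def)
  then show ?thesis
    unfolding closed_subalgebra_def using zero add mult comp closed by (intro conjI ballI allI)
qed

section \<open>The two inclusions and the two ranges of exponents\<close>

lemma reduced_group_algebra_subset:
  fixes d :: "'g::group_add \<Rightarrow> 'g \<Rightarrow> real"
  assumes "p > 1" and d: "proper_right_invariant_metric d"
  shows "reduced_group_algebra p \<subseteq> invariant_uniform_Roe_algebra p d"
  unfolding reduced_group_algebra_def
proof (rule hull_minimal)
  have p: "p > 0" using assms(1) by simp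
  have "matrix_entry (left_regular p g) (s + h) (t + h) = matrix_entry (left_regular p g) s t" for g h s t :: 'g
    by (simp add: matrix_entry_left_regular[OF p] add.assoc[symmetric])
  then have "\<forall>h. right_regular p h \<circ> left_regular p g \<circ> right_regular p (- h) = left_regular p g" for g :: 'g
    using right_invariant_iff[OF assms(1) regular_bounded_operators(1)[OF assms(1)]] by blast
  then show "range (left_regular p) \<subseteq> invariant_uniform_Roe_algebra p d"
    using left_regular_mem_uniform_Roe_algebra[OF assms] by (auto simp: invariant_uniform_Roe_algebra_def)
qed (rule closed_subalgebra_invariant_uniform_Roe_algebra[OF assms])

text \<open>The condition \<open>column\<close> is left open since its source differs: for
  \<open>r = p\<close> it is the norm of a column of the matrix, for the conjugate exponent that of
  a row.\<close>

lemma ITAP_criterion: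
  fixes d :: "'g::group_add \<Rightarrow> 'g \<Rightarrow> real" and l :: "'g \<Rightarrow> real"
  assumes "p > 1" "r > 0" and d: "proper_right_invariant_metric d"
    and l: "length_function l" "negative_type l"
    and bd: "C > 0" "s > 0" "convolution_bound p r l C s"
    and column: "\<And>T F. T \<in> invariant_uniform_Roe_algebra p d \<Longrightarrow> finite F \<Longrightarrow>
      pnorm r F (\<lambda>g. matrix_entry T g 0) \<le> op_norm p T"
  shows "ITAP p d"
  unfolding ITAP_def
proof (rule antisym[OF reduced_group_algebra_subset[OF assms(1) d]], rule subsetI)
  fix T assume T: "T \<in> invariant_uniform_Roe_algebra p d"
  show "T \<in> reduced_group_algebra p"
    unfolding reduced_group_algebra_def hull_def
  proof (clarify)
    fix M :: "(('g \<Rightarrow> complex) \<Rightarrow> 'g \<Rightarrow> complex) set"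
    assume M: "closed_subalgebra p M" "range (left_regular p) \<subseteq> M"
    show "T \<in> M"
      by (rule invariant_operator_mem_closed_subalgebra[OF assms(1,2) d l bd T _ M])
        (rule column[OF T])
  qed
qed

lemma invariant_operator_bounded:
  "T \<in> invariant_uniform_Roe_algebra p d \<Longrightarrow> T \<in> bounded_operators p"
  by (simp add: invariant_uniform_Roe_algebra_def uniform_Roe_algebra_def op_closure_def)

lemma ITAP_if_convolution_bound:
  fixes d :: "'g::group_add \<Rightarrow> 'g \<Rightarrow> real" and l :: "'g \<Rightarrow> real"
  assumes "p > 1" and "proper_right_invariant_metric d" "length_function l" "negative_type l"
    "C > 0" "s > 0" "convolution_bound p p l C s"
  shows "ITAP p d"
proof (rule ITAP_criterion[OF assms(1) _ assms(2-7)])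
  show "pnorm p F (\<lambda>g. matrix_entry T g 0) \<le> op_norm p T"
    if "T \<in> invariant_uniform_Roe_algebra p d" "finite F" for T F
    using matrix_bound_column[OF matrix_bound_op_norm[OF assms(1) invariant_operator_bounded[OF that(1)]] _ that(2)]
      assms(1) by simp
qed (use assms(1) in simp)

text \<open>Rows of a matrix bounded for exponent \<open>p\<close> have finite norm for exponent
  \<open>q\<close>. For an invariant operator the row at the unit is the column at the unit composed
  with inversion, so the symbol gets the exponent that the transposed convolution bound
  requires.\<close>

lemma ITAP_dual_if_convolution_bound:
  fixes d :: "'g::group_add \<Rightarrow> 'g \<Rightarrow> real" and l :: "'g \<Rightarrow> real"
  assumes pq: "p > 1" "q > 1" "1/p + 1/q = 1"
    and d: "proper_right_invariant_metric d" and l: "length_function l" "negative_type l"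
    and bd: "C > 0" "s > 0" "convolution_bound q q l C s"
  shows "ITAP p d"
proof (rule ITAP_criterion[OF pq(1) _ d l bd(1,2)])
  show "q > 0" using pq by simp
  show "convolution_bound p q l C s"
    by (rule convolution_bound_transpose[OF pq(2,1) _ l(1) bd(3)]) (use pq(3) in simp)
  fix T :: "('g \<Rightarrow> complex) \<Rightarrow> 'g \<Rightarrow> complex" and F :: "'g set"
  assume T: "T \<in> invariant_uniform_Roe_algebra p d" and F: "finite F"
  note TB = invariant_operator_bounded[OF T]
  have inv: "matrix_entry T (s + g) (t + g) = matrix_entry T s t" for s t g
    using T right_invariant_iff[OF pq(1) TB] by (simp add: invariant_uniform_Roe_algebra_def)
  have "matrix_bound q (\<lambda>s t. matrix_entry T t s) (op_norm p T)"
    by (rule matrix_bound_transpose[OF pq matrix_bound_op_norm[OF pq(1) TB]])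
  from matrix_bound_column[OF this, of "uminus ` F" 0]
  have "pnorm q (uminus ` F) (\<lambda>g. matrix_entry T 0 g) \<le> op_norm p T"
    using pq F by simp
  moreover have "pnorm q (uminus ` F) (\<lambda>g. matrix_entry T 0 g) = pnorm q F (\<lambda>g. matrix_entry T g 0)"
  proof -
    have "matrix_entry T 0 (- g) = matrix_entry T g 0" for g
      using inv[of 0 g "- g"] by simp
    then show ?thesis
      unfolding pnorm_def by (subst sum.reindex) auto
  qed
  ultimately show "pnorm q F (\<lambda>g. matrix_entry T g 0) \<le> op_norm p T" by simp
qed

theorem proposition4p7:
  fixes d :: "'g::group_add \<Rightarrow> 'g \<Rightarrow> real"
  assumes "proper_right_invariant_metric d"
  shows "(\<forall>p>1. (\<exists>l::'g \<Rightarrow> real. length_function l \<and> negative_type l \<and> property_RD p l)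
             \<longrightarrow> ITAP p d)
       \<and> ((\<exists>l::'g \<Rightarrow> real. length_function l \<and> negative_type l \<and> property_RD 2 l)
             \<longrightarrow> (\<forall>p>1. ITAP p d))"
proof (intro conjI allI impI; elim exE conjE)
  fix p :: real and l :: "'g \<Rightarrow> real"
  assume p: "p > 1" and l: "length_function l" "negative_type l" "property_RD p l"
  obtain C s where "C > 0" "s > 0" "convolution_bound p p l C s"
    using property_RD_convolution_bound[OF p l(3)] .
  then show "ITAP p d"
    by (rule ITAP_if_convolution_bound[OF p assms l(1,2)])
next
  fix p :: real and l :: "'g \<Rightarrow> real"
  assume p: "p > 1" and l: "length_function l" "negative_type l" "property_RD 2 l"
  obtain C s where C: "C > 0" "s > 0" "convolution_bound 2 2 l C s"
    using property_RD_convolution_bound[OF _ l(3)] by auto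
  \<comment> \<open>The endpoint 2 is the hypothesis itself; interpolation covers the open
    interval.\<close>
  have bound: "\<exists>C s. C > 0 \<and> s > 0 \<and> convolution_bound r r l C s" if r: "1 < r" "r \<le> 2" for r
  proof (cases "r = 2")
    case True
    then show ?thesis using C by blast
  next
    case False
    then have "convolution_bound r r l (C powr (2 * (r - 1) / r)) (2 * s / r)"
      using r by (intro convolution_bound_interpolate l C) auto
    moreover have "C powr (2 * (r - 1) / r) > 0" "2 * s / r > 0" using r C by auto
    ultimately show ?thesis by blast
  qed
  show "ITAP p d"
  proof (cases "p \<le> 2")
    case True
    then show ?thesis using bound[OF p] ITAP_if_convolution_bound[OF p assms l(1,2)] by blast
  next
    case False
    \<comment> \<open>For \<open>p\<close> above 2 the conjugate exponent falls below 2, where the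
      interpolated bound is available.\<close>
    obtain q where q: "q > 1" "1/p + 1/q = 1" using conjugate_exponent[OF p] .
    have "1/p \<le> 1/2" using False by (simp add: field_simps)
    with q(2) have "1/q \<ge> 1/2" by linarith
    then have "q \<le> 2" using q(1) by (simp add: field_simps)
    then show ?thesis using bound[OF q(1)] ITAP_dual_if_convolution_bound[OF p q assms l(1,2)] by blast
  qed
qed

end
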